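(* The implications $E\leadsto_{\rm loc}F\Rightarrow E\leadsto_{\rm q}F$ and $E\leadsto_{\rm q}F\Rightarrow E\leadsto_{\rm ns}F$ (for hypergraphs $E,F$) are not reversible; that is, there exist hypergraphs $E,F$ with $E\leadsto_{\rm q}F$ but $E\not\leadsto_{\rm loc}F$, and there exist hypergraphs $E,F$ with $E\leadsto_{\rm ns}F$ but $E\not\leadsto_{\rm q}F$.
   Context: A hypergraph is a subset $E\subseteq V\times W$ with $V,W$ finite sets. $\mathcal D_V$ is the algebra of complex diagonal $V\times V$ matrices with diagonal matrix units $\epsilon_{v,v}$; $VW=V\times W$. A channel is a positive trace-preserving linear map $\mathcal E:\mathcal D_V\to\mathcal D_W$; $\mathcal E(w|v)$ is the $(w,w)$ entry of $\mathcal E(\epsilon_{v,v})$. A POVM is a finite family of positive operators on a Hilbert space summing to $I$. An NS correlation over a quadruple $(V_2,W_1,V_1,W_2)$ of finite sets is a channel $\Gamma:\mathcal D_{V_2W_1}\to\mathcal D_{V_1W_2}$ such that $\sum_{w_2}\Gamma(v_1,w_2|v_2,w_1)$ does not depend on $w_1$ and $\sum_{v_1}\Gamma(v_1,w_2|v_2,w_1)$ does not depend on $v_2$; $\mathcal C_{\rm ns}$ is the set of these. $\Gamma$ is quantum ($\Gamma\in\mathcal C_{\rm q}$) if there are finite dimensional Hilbert spaces $H_V,H_W$, POVMs $(E_{v_2,v_1})_{v_1}$ on $H_V$ ($v_2\in V_2$) and $(F_{w_1,w_2})_{w_2}$ on $H_W$ ($w_1\in W_1$), and a unit vector $\xi\in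 H_V\otimes H_W$ with $\Gamma(v_1,w_2|v_2,w_1)=\langle(E_{v_2,v_1}\otimes F_{w_1,w_2})\xi,\xi\rangle$. $\Gamma$ is local ($\Gamma\in\mathcal C_{\rm loc}$) if it is a convex combination of $\Phi\otimes\Psi$ with channels $\Phi:\mathcal D_{V_2}\to\mathcal D_{V_1}$, $\Psi:\mathcal D_{W_1}\to\mathcal D_{W_2}$. For hypergraphs $E_i\subseteq V_i\times W_i$, $i=1,2$, and ${\rm t}\in\{{\rm loc,q,ns}\}$, $E_1\leadsto_{\rm t}E_2$ means that there is $\Gamma\in\mathcal C_{\rm t}$ over $(V_2,W_1,V_1,W_2)$ such that $\Gamma(v_1,w_2|v_2,w_1)\ne0$ and $(v_1,w_1)\in E_1$ imply $(v_2,w_2)\in E_2$. *)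

theory Defs
  imports "Jordan_Normal_Form.Matrix"
begin

section \<open>Hypergraphs\<close>

definition hypergraph :: "'v set \<Rightarrow> 'w set \<Rightarrow> ('v \<times> 'w) set \<Rightarrow> bool" where
  "hypergraph V W E \<longleftrightarrow> finite V \<and> finite W \<and> E \<subseteq> V \<times> W"


section \<open>Diagonal matrices and channels\<close>

text \<open>A complex \<open>V \<times> V\<close> matrix, with \<open>V\<close> a finite subset of the type \<open>'v\<close>, is a
  function \<open>'v \<Rightarrow> 'v \<Rightarrow> complex\<close> that vanishes outside \<open>V \<times> V\<close>.\<close>

type_synonym 'v imat = "'v \<Rightarrow> 'v \<Rightarrow> complex"

definition diag_alg :: "'v set \<Rightarrow> 'v imat set" where
  "diag_alg V = {M. \<forall>i j. M i j \<noteq> 0 \<longrightarrow> i = j \<and> i \<in> V}"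

definition matrix_unit :: "'v \<Rightarrow> 'v imat" where
  "matrix_unit v = (\<lambda>i j. if i = v \<and> j = v then 1 else 0)"

text \<open>Inequalities between complex numbers refer to \<open>HOL-Library.Complex_Order\<close>: \<open>0 \<le> z\<close>
  means that \<open>z\<close> is real and nonnegative.\<close>

definition positive_imat :: "'v set \<Rightarrow> 'v imat \<Rightarrow> bool" where
  "positive_imat V M \<longleftrightarrow> (\<forall>x :: 'v \<Rightarrow> complex. 0 \<le> (\<Sum>i\<in>V. \<Sum>j\<in>V. M i j * x j * cnj (x i)))"

definition trace_imat :: "'v set \<Rightarrow> 'v imat \<Rightarrow> complex" where
  "trace_imat V M = (\<Sum>i\<in>V. M i i)"

text \<open>Only the values of a channel on \<open>diag_alg V\<close> are meaningful.\<close>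

definition channel :: "'v set \<Rightarrow> 'w set \<Rightarrow> ('v imat \<Rightarrow> 'w imat) \<Rightarrow> bool" where
  "channel V W \<E> \<longleftrightarrow>
     (\<forall>M\<in>diag_alg V. \<E> M \<in> diag_alg W) \<and>
     (\<forall>M\<in>diag_alg V. \<forall>N\<in>diag_alg V.
        \<E> (\<lambda>i j. M i j + N i j) = (\<lambda>i j. \<E> M i j + \<E> N i j)) \<and>
     (\<forall>c. \<forall>M\<in>diag_alg V. \<E> (\<lambda>i j. c * M i j) = (\<lambda>i j. c * \<E> M i j)) \<and>
     (\<forall>M\<in>diag_alg V. positive_imat V M \<longrightarrow> positive_imat W (\<E> M)) \<and>
     (\<forall>M\<in>diag_alg V. trace_imat W (\<E> M) = trace_imat V M)"

text \<open>\<open>entry \<E> w v\<close> is written \<open>\<E>(w|v)\<close> on paper.\<close>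

definition entry :: "('v imat \<Rightarrow> 'w imat) \<Rightarrow> 'w \<Rightarrow> 'v \<Rightarrow> complex" where
  "entry \<E> w v = \<E> (matrix_unit v) w w"

text \<open>The tensor product of linear maps on diagonal algebras, by linear extension from
  the products of matrix units; the algebra over \<open>V \<times> W\<close> is identified with the tensor
  product of the algebras over \<open>V\<close> and over \<open>W\<close>.\<close>

definition tensor_map ::
  "'v set \<Rightarrow> 'w set \<Rightarrow> ('v imat \<Rightarrow> 'a imat) \<Rightarrow> ('w imat \<Rightarrow> 'b imat)
     \<Rightarrow> ('v \<times> 'w) imat \<Rightarrow> ('a \<times> 'b) imat" where
  "tensor_map V W \<Phi> \<Psi> M =
     (\<lambda>(a, b) (a', b'). \<Sum>v\<in>V. \<Sum>w\<in>W.
        M (v, w) (v, w) * (\<Phi> (matrix_unit v) a a' * \<Psi> (matrix_unit w) b b'))"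


section \<open>Finite dimensional Hilbert spaces and POVMs\<close>

text \<open>A finite dimensional Hilbert space is \<open>\<complex>\<^sup>d\<close> for some \<open>d\<close>, with operators the
  \<open>d \<times> d\<close> matrices.  The scalar product \<open>\<bullet>c\<close> is conjugate linear in its second argument.\<close>

definition positive_op :: "nat \<Rightarrow> complex mat \<Rightarrow> bool" where
  "positive_op d A \<longleftrightarrow> A \<in> carrier_mat d d \<and> (\<forall>x\<in>carrier_vec d. 0 \<le> (A *\<^sub>v x) \<bullet>c x)"

definition povm :: "nat \<Rightarrow> 'a set \<Rightarrow> ('a \<Rightarrow> complex mat) \<Rightarrow> bool" where
  "povm d A P \<longleftrightarrow> finite A \<and> (\<forall>a\<in>A. positive_op d (P a)) \<and>
     mat d d (\<lambda>ij. \<Sum>a\<in>A. P a $$ ij) = 1\<^sub>m d"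

text \<open>\<open>\<complex>\<^sup>m \<otimes> \<complex>\<^sup>n\<close> is identified with \<open>\<complex>\<^sup>m\<^sup>n\<close>, the basis vector \<open>e\<^sub>i \<otimes> e\<^sub>j\<close> with
  \<open>e\<close> of index \<open>i * n + j\<close>; the tensor product of operators is then the Kronecker product.\<close>

definition kronecker :: "complex mat \<Rightarrow> complex mat \<Rightarrow> complex mat" where
  "kronecker A B = mat (dim_row A * dim_row B) (dim_col A * dim_col B)
     (\<lambda>(i, j). A $$ (i div dim_row B, j div dim_col B) * B $$ (i mod dim_row B, j mod dim_col B))"


section \<open>Classes of no-signalling correlations\<close>

type_synonym ('v2, 'w1, 'v1, 'w2) corr = "('v2 \<times> 'w1) imat \<Rightarrow> ('v1 \<times> 'w2) imat"

definition C_ns :: "'v2 set \<Rightarrow> 'w1 set \<Rightarrow> 'v1 set \<Rightarrow> 'w2 set \<Rightarrow> ('v2, 'w1, 'v1, 'w2) corr set" where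
  "C_ns V2 W1 V1 W2 = {\<Gamma>. channel (V2 \<times> W1) (V1 \<times> W2) \<Gamma> \<and>
     (\<forall>v2\<in>V2. \<forall>v1\<in>V1. \<forall>w1\<in>W1. \<forall>w1'\<in>W1.
        (\<Sum>w2\<in>W2. entry \<Gamma> (v1, w2) (v2, w1)) = (\<Sum>w2\<in>W2. entry \<Gamma> (v1, w2) (v2, w1'))) \<and>
     (\<forall>w1\<in>W1. \<forall>w2\<in>W2. \<forall>v2\<in>V2. \<forall>v2'\<in>V2.
        (\<Sum>v1\<in>V1. entry \<Gamma> (v1, w2) (v2, w1)) = (\<Sum>v1\<in>V1. entry \<Gamma> (v1, w2) (v2', w1)))}"

definition C_q :: "'v2 set \<Rightarrow> 'w1 set \<Rightarrow> 'v1 set \<Rightarrow> 'w2 set \<Rightarrow> ('v2, 'w1, 'v1, 'w2) corr set" where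
  "C_q V2 W1 V1 W2 = {\<Gamma> \<in> C_ns V2 W1 V1 W2.
     \<exists>(m :: nat) (n :: nat) P Q \<xi>.
       (\<forall>v2\<in>V2. povm m V1 (P v2)) \<and> (\<forall>w1\<in>W1. povm n W2 (Q w1)) \<and>
       \<xi> \<in> carrier_vec (m * n) \<and> \<xi> \<bullet>c \<xi> = 1 \<and>
       (\<forall>v2\<in>V2. \<forall>w1\<in>W1. \<forall>v1\<in>V1. \<forall>w2\<in>W2.
          entry \<Gamma> (v1, w2) (v2, w1) = (kronecker (P v2 v1) (Q w1 w2) *\<^sub>v \<xi>) \<bullet>c \<xi>)}"

definition C_loc :: "'v2 set \<Rightarrow> 'w1 set \<Rightarrow> 'v1 set \<Rightarrow> 'w2 set \<Rightarrow> ('v2, 'w1, 'v1, 'w2) corr set" where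
  "C_loc V2 W1 V1 W2 = {\<Gamma> \<in> C_ns V2 W1 V1 W2.
     \<exists>(n :: nat) (p :: nat \<Rightarrow> real) \<Phi> \<Psi>.
       (\<forall>k<n. 0 \<le> p k \<and> channel V2 V1 (\<Phi> k) \<and> channel W1 W2 (\<Psi> k)) \<and> (\<Sum>k<n. p k) = 1 \<and>
       (\<forall>M\<in>diag_alg (V2 \<times> W1).
          \<Gamma> M = (\<lambda>x y. \<Sum>k<n. complex_of_real (p k) * tensor_map V2 W1 (\<Phi> k) (\<Psi> k) M x y))}"


section \<open>The relations between hypergraphs\<close>

definition leads_via ::
  "('v2, 'w1, 'v1, 'w2) corr set \<Rightarrow> 'v1 set \<Rightarrow> 'w1 set \<Rightarrow> ('v1 \<times> 'w1) set
     \<Rightarrow> 'v2 set \<Rightarrow> 'w2 set \<Rightarrow> ('v2 \<times> 'w2) set \<Rightarrow> bool" where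
  "leads_via C V1 W1 E1 V2 W2 E2 \<longleftrightarrow>
     (\<exists>\<Gamma>\<in>C. \<forall>v1\<in>V1. \<forall>w1\<in>W1. \<forall>v2\<in>V2. \<forall>w2\<in>W2.
        entry \<Gamma> (v1, w2) (v2, w1) \<noteq> 0 \<and> (v1, w1) \<in> E1 \<longrightarrow> (v2, w2) \<in> E2)"

definition leads_loc ::
  "'v1 set \<Rightarrow> 'w1 set \<Rightarrow> ('v1 \<times> 'w1) set \<Rightarrow> 'v2 set \<Rightarrow> 'w2 set \<Rightarrow> ('v2 \<times> 'w2) set \<Rightarrow> bool" where
  "leads_loc V1 W1 E1 V2 W2 E2 \<longleftrightarrow> leads_via (C_loc V2 W1 V1 W2) V1 W1 E1 V2 W2 E2"

definition leads_q ::
  "'v1 set \<Rightarrow> 'w1 set \<Rightarrow> ('v1 \<times> 'w1) set \<Rightarrow> 'v2 set \<Rightarrow> 'w2 set \<Rightarrow> ('v2 \<times> 'w2) set \<Rightarrow> bool" where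
  "leads_q V1 W1 E1 V2 W2 E2 \<longleftrightarrow> leads_via (C_q V2 W1 V1 W2) V1 W1 E1 V2 W2 E2"

definition leads_ns ::
  "'v1 set \<Rightarrow> 'w1 set \<Rightarrow> ('v1 \<times> 'w1) set \<Rightarrow> 'v2 set \<Rightarrow> 'w2 set \<Rightarrow> ('v2 \<times> 'w2) set \<Rightarrow> bool" where
  "leads_ns V1 W1 E1 V2 W2 E2 \<longleftrightarrow> leads_via (C_ns V2 W1 V1 W2) V1 W1 E1 V2 W2 E2"

text \<open>A hypergraph over nonempty sets. Empty sets have to be kept
  out of counterexamples: for \<open>V2 = {}\<close>, \<open>W2 = {}\<close> and \<open>W1 \<noteq> {}\<close> the zero map is an NS
  correlation, whereas there is no POVM indexed by \<open>W2\<close> on a nonzero space, so that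
  \<open>leads_ns\<close> and \<open>leads_q\<close> differ for a trivial reason.\<close>

definition proper_hypergraph :: "'v set \<Rightarrow> 'w set \<Rightarrow> ('v \<times> 'w) set \<Rightarrow> bool" where
  "proper_hypergraph V W E \<longleftrightarrow> hypergraph V W E \<and> V \<noteq> {} \<and> W \<noteq> {}"

end

theory Submission
  imports Defs
begin

text \<open>For \<open>V\<^sub>1 = W\<^sub>1 = {..<n}\<close> and the identity hypergraph \<open>E\<close>, a local perfect strategy is a cover of
  \<open>V\<^sub>2\<close> by \<open>n\<close> faces, the faces being the sets \<open>{x. (x, b) \<in> F}\<close> for \<open>b \<in> W\<^sub>2\<close>: Alice names a colour \<open>a\<close>
  for the point \<open>x\<close>, and Bob's face for the colour \<open>a\<close> has to contain \<open>x\<close>.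

  Quantum but not local: the \<open>18\<close> points are a cell of the Peres-Mermin square together with a bit,
  the faces are the assignments of bits with even sum to the cells of a line, and \<open>n = 6\<close>. Six faces of
  size \<open>3\<close> would partition the points, and then the number of points with bit \<open>1\<close>, which is \<open>9\<close>,
  would be even. With a maximally entangled state on \<open>\<complex>\<^sup>4 \<otimes> \<complex>\<^sup>4\<close>, Bob measures the joint eigenbasis
  of the line, and Alice measures the observable of the cell and names the row or the column of the cell
  according to the outcome.

  No-signalling but not quantum: the points are the \<open>6\<close> edges of \<open>K\<^sub>4\<close>, the faces are its triangles, and
  \<open>n = 2\<close>. Every edge lies in half of the triangles, which yields a no-signalling strategy. Two triangles
  never cover, so for every two of them some question to Alice separates the vectors that
  the corresponding outcomes of Bob's two measurements produce from \<open>\<xi>\<close>. These vectors are thus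
  orthogonal, but both families sum to \<open>\<xi>\<close>.\<close>

section \<open>Channels given by stochastic kernels\<close>

text \<open>The map reads off the diagonal of \<open>M\<close> only, so additivity and homogeneity
  hold for arbitrary matrices and not just on \<open>diag_alg V\<close>.\<close>

definition kernel_channel :: "'v set \<Rightarrow> 'w set \<Rightarrow> ('w \<Rightarrow> 'v \<Rightarrow> real) \<Rightarrow> 'v imat \<Rightarrow> 'w imat" where
  "kernel_channel V W k M =
     (\<lambda>i j. if i = j \<and> i \<in> W then \<Sum>v\<in>V. complex_of_real (k i v) * M v v else 0)"

lemma entry_kernel_channel:
  assumes "finite V" "v \<in> V" "w \<in> W"
  shows "entry (kernel_channel V W k) w v = complex_of_real (k w v)"
proof -
  have "(\<Sum>u\<in>V. complex_of_real (k w u) * matrix_unit v u u) =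
      (\<Sum>u\<in>V. if u = v then complex_of_real (k w u) else 0)"
    by (rule sum.cong) (auto simp: matrix_unit_def)
  then show ?thesis
    using assms by (simp add: entry_def kernel_channel_def)
qed

lemma matrix_unit_diag_alg: "v \<in> V \<Longrightarrow> matrix_unit v \<in> diag_alg V"
  by (auto simp: diag_alg_def matrix_unit_def split: if_splits)

lemma quadratic_form_diag:
  assumes "finite V" "M \<in> diag_alg V"
  shows "(\<Sum>i\<in>V. \<Sum>j\<in>V. M i j * x j * cnj (x i)) = (\<Sum>i\<in>V. M i i * (x i * cnj (x i)))"
proof (rule sum.cong)
  fix i assume i: "i \<in> V"
  have "(\<Sum>j\<in>V. M i j * x j * cnj (x i)) = (\<Sum>j\<in>V. if j = i then M i i * (x i * cnj (x i)) else 0)"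
    using assms(2) by (intro sum.cong) (auto simp: diag_alg_def)
  then show "(\<Sum>j\<in>V. M i j * x j * cnj (x i)) = M i i * (x i * cnj (x i))"
    using assms(1) i by simp
qed simp

lemma mult_cnj_nonneg: "0 \<le> z * cnj (z :: complex)"
  by (simp add: less_eq_complex_def complex_mult_cnj)

lemma complex_of_real_nonneg: "0 \<le> r \<Longrightarrow> 0 \<le> complex_of_real r"
  by (simp add: less_eq_complex_def)

lemma positive_imat_diag_iff:
  assumes "finite V" "M \<in> diag_alg V"
  shows "positive_imat V M \<longleftrightarrow> (\<forall>v\<in>V. 0 \<le> M v v)"
proof
  assume pos: "positive_imat V M"
  show "\<forall>v\<in>V. 0 \<le> M v v"
  proof
    fix v assume v: "v \<in> V"
    have "0 \<le> (\<Sum>i\<in>V. M i i * ((if i = v then 1 else 0) * cnj (if i = v then 1 else 0)))"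
      using pos unfolding positive_imat_def quadratic_form_diag[OF assms]
      by (elim allE[where x = "\<lambda>i. if i = v then 1 else 0"])
    also have "\<dots> = (\<Sum>i\<in>V. if i = v then M v v else 0)"
      by (rule sum.cong) auto
    finally show "0 \<le> M v v" using assms(1) v by simp
  qed
next
  assume "\<forall>v\<in>V. 0 \<le> M v v"
  then show "positive_imat V M"
    unfolding positive_imat_def quadratic_form_diag[OF assms]
    by (auto intro!: sum_nonneg mult_nonneg_nonneg mult_cnj_nonneg simp del: complex_cnj_mult)
qed

lemma channel_kernel_channel:
  assumes fin: "finite V" "finite W"
    and nonneg: "\<And>v w. v \<in> V \<Longrightarrow> w \<in> W \<Longrightarrow> 0 \<le> k w v"
    and total: "\<And>v. v \<in> V \<Longrightarrow> (\<Sum>w\<in>W. k w v) = 1"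
  shows "channel V W (kernel_channel V W k)"
proof -
  have diag: "kernel_channel V W k M \<in> diag_alg W" for M
    by (auto simp: kernel_channel_def diag_alg_def)
  have add: "kernel_channel V W k (\<lambda>i j. M i j + N i j) =
      (\<lambda>i j. kernel_channel V W k M i j + kernel_channel V W k N i j)" for M N
    by (auto simp: kernel_channel_def fun_eq_iff distrib_left sum.distrib)
  have scale: "kernel_channel V W k (\<lambda>i j. c * M i j) =
      (\<lambda>i j. c * kernel_channel V W k M i j)" for c M
    by (auto simp: kernel_channel_def fun_eq_iff sum_distrib_left intro!: sum.cong)
  have pos: "positive_imat W (kernel_channel V W k M)"
    if "M \<in> diag_alg V" "positive_imat V M" for M
  proof -
    have "0 \<le> kernel_channel V W k M w w" if "w \<in> W" for w
      using that \<open>M \<in> diag_alg V\<close> \<open>positive_imat V M\<close> fin nonneg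
      by (auto simp: positive_imat_diag_iff kernel_channel_def
          intro!: sum_nonneg mult_nonneg_nonneg complex_of_real_nonneg)
    then show ?thesis using fin by (simp add: positive_imat_diag_iff diag)
  qed
  have trace: "trace_imat W (kernel_channel V W k M) = trace_imat V M" for M
  proof -
    have "trace_imat W (kernel_channel V W k M) =
        (\<Sum>v\<in>V. \<Sum>w\<in>W. complex_of_real (k w v) * M v v)"
      unfolding trace_imat_def kernel_channel_def by (subst sum.swap) simp
    also have "\<dots> = (\<Sum>v\<in>V. complex_of_real (\<Sum>w\<in>W. k w v) * M v v)"
      by (simp add: sum_distrib_right)
    also have "\<dots> = trace_imat V M"
      by (simp add: trace_imat_def total)
    finally show ?thesis .
  qed
  show ?thesis
    unfolding channel_def using diag add scale pos trace by blast
qed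

text \<open>No-signalling is expressed by naming the marginals: \<open>p\<close> cannot mention
  \<open>w1\<close> and \<open>q\<close> cannot mention \<open>v2\<close>. Summing \<open>p\<close>
  over \<open>v1\<close> then gives trace preservation.\<close>

lemma C_ns_kernel_channel:
  assumes fin: "finite V2" "finite W1" "finite V1" "finite W2"
    and nonneg: "\<And>v2 w1 v1 w2. \<lbrakk>v2 \<in> V2; w1 \<in> W1; v1 \<in> V1; w2 \<in> W2\<rbrakk> \<Longrightarrow>
      0 \<le> k (v1, w2) (v2, w1)"
    and margV: "\<And>v2 w1 v1. \<lbrakk>v2 \<in> V2; w1 \<in> W1; v1 \<in> V1\<rbrakk> \<Longrightarrow>
      (\<Sum>w2\<in>W2. k (v1, w2) (v2, w1)) = p v1 v2"
    and margW: "\<And>v2 w1 w2. \<lbrakk>v2 \<in> V2; w1 \<in> W1; w2 \<in> W2\<rbrakk> \<Longrightarrow>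
      (\<Sum>v1\<in>V1. k (v1, w2) (v2, w1)) = q w2 w1"
    and total: "\<And>v2. v2 \<in> V2 \<Longrightarrow> (\<Sum>v1\<in>V1. p v1 v2) = 1"
  shows "kernel_channel (V2 \<times> W1) (V1 \<times> W2) k \<in> C_ns V2 W1 V1 W2"
proof -
  have "(\<Sum>z\<in>V1 \<times> W2. k z u) = 1" if "u \<in> V2 \<times> W1" for u
  proof -
    obtain v2 w1 where u: "u = (v2, w1)" "v2 \<in> V2" "w1 \<in> W1" using \<open>u \<in> V2 \<times> W1\<close> by blast
    have "(\<Sum>z\<in>V1 \<times> W2. k z u) = (\<Sum>v1\<in>V1. \<Sum>w2\<in>W2. k (v1, w2) u)"
      using sum.cartesian_product[of "\<lambda>v1 w2. k (v1, w2) u" W2 V1] by simp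
    then show ?thesis using u margV total by simp
  qed
  then have ch: "channel (V2 \<times> W1) (V1 \<times> W2) (kernel_channel (V2 \<times> W1) (V1 \<times> W2) k)"
    using fin nonneg by (intro channel_kernel_channel) auto
  have "(\<Sum>w2\<in>W2. entry (kernel_channel (V2 \<times> W1) (V1 \<times> W2) k) (v1, w2) (v2, w1)) =
      complex_of_real (p v1 v2)" if "v2 \<in> V2" "w1 \<in> W1" "v1 \<in> V1" for v2 w1 v1
    using that fin margV by (simp add: entry_kernel_channel flip: of_real_sum)
  moreover have "(\<Sum>v1\<in>V1. entry (kernel_channel (V2 \<times> W1) (V1 \<times> W2) k) (v1, w2) (v2, w1)) =
      complex_of_real (q w2 w1)" if "v2 \<in> V2" "w1 \<in> W1" "w2 \<in> W2" for v2 w1 w2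
    using that fin margW by (simp add: entry_kernel_channel flip: of_real_sum)
  ultimately show ?thesis
    using ch by (simp add: C_ns_def)
qed

section \<open>Local correlations\<close>

lemma channel_entry_nonneg:
  assumes "channel V W \<E>" "finite V" "finite W" "v \<in> V" "w \<in> W"
  shows "0 \<le> entry \<E> w v"
proof -
  have mu: "matrix_unit v \<in> diag_alg V" using assms(4) by (rule matrix_unit_diag_alg)
  then have "positive_imat V (matrix_unit v)"
    using assms(2) by (simp add: positive_imat_diag_iff)
      (simp add: matrix_unit_def less_eq_complex_def)
  then have "positive_imat W (\<E> (matrix_unit v))" "\<E> (matrix_unit v) \<in> diag_alg W"
    using assms(1) mu unfolding channel_def by blast+
  then show ?thesis
    using assms by (simp add: positive_imat_diag_iff entry_def)
qed

lemma channel_entry_total: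
  assumes "channel V W \<E>" "finite V" "v \<in> V"
  shows "(\<Sum>w\<in>W. entry \<E> w v) = 1"
proof -
  have "trace_imat W (\<E> (matrix_unit v)) = trace_imat V (matrix_unit v)"
    using assms(1) matrix_unit_diag_alg[OF assms(3)] unfolding channel_def by blast
  also have "\<dots> = (\<Sum>u\<in>V. if u = v then 1 else 0)"
    unfolding trace_imat_def matrix_unit_def by (rule sum.cong) auto
  finally show ?thesis using assms by (simp add: trace_imat_def entry_def)
qed

lemma channel_entry_nonzero:
  assumes "channel V W \<E>" "finite V" "v \<in> V"
  obtains w where "w \<in> W" "entry \<E> w v \<noteq> 0"
  using channel_entry_total[OF assms] by (metis sum.neutral zero_neq_one)

lemma entry_tensor_map:
  assumes "finite V" "finite W" "v \<in> V" "w \<in> W"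
  shows "entry (tensor_map V W \<Phi> \<Psi>) (a, b) (v, w) = entry \<Phi> a v * entry \<Psi> b w"
proof -
  have "entry (tensor_map V W \<Phi> \<Psi>) (a, b) (v, w) =
      (\<Sum>v'\<in>V. \<Sum>w'\<in>W. if w' = w then (if v' = v then entry \<Phi> a v * entry \<Psi> b w else 0) else 0)"
    unfolding entry_def tensor_map_def
    by (simp, intro sum.cong) (auto simp: matrix_unit_def)
  then show ?thesis using assms by simp
qed

text \<open>All terms of the convex combination have nonnegative entries, so nothing cancels and the
  support of \<Gamma> contains that of any product with positive weight. Picking one possible output
  per input in such a product gives \<open>f\<close> and \<open>g\<close>.\<close>

lemma leads_loc_deterministic:
  assumes fin: "finite V1" "finite W1" "finite V2" "finite W2"
    and "leads_loc V1 W1 E V2 W2 F"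
  obtains f g where "f \<in> V2 \<rightarrow> V1" "g \<in> W1 \<rightarrow> W2"
    "\<And>x y. x \<in> V2 \<Longrightarrow> y \<in> W1 \<Longrightarrow> (f x, y) \<in> E \<Longrightarrow> (x, g y) \<in> F"
proof -
  obtain \<Gamma> where \<Gamma>: "\<Gamma> \<in> C_loc V2 W1 V1 W2" and
    win: "\<And>v1 w1 v2 w2. \<lbrakk>v1 \<in> V1; w1 \<in> W1; v2 \<in> V2; w2 \<in> W2;
      entry \<Gamma> (v1, w2) (v2, w1) \<noteq> 0; (v1, w1) \<in> E\<rbrakk> \<Longrightarrow> (v2, w2) \<in> F"
    using assms(5) unfolding leads_loc_def leads_via_def by blast
  obtain n p \<Phi> \<Psi> where
    ch: "\<And>k. k < (n::nat) \<Longrightarrow> 0 \<le> p k \<and> channel V2 V1 (\<Phi> k) \<and> channel W1 W2 (\<Psi> k)" and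
    p: "(\<Sum>k<n. p k) = (1::real)" and
    eq: "\<And>M. M \<in> diag_alg (V2 \<times> W1) \<Longrightarrow>
      \<Gamma> M = (\<lambda>x y. \<Sum>k<n. complex_of_real (p k) * tensor_map V2 W1 (\<Phi> k) (\<Psi> k) M x y)"
    using \<Gamma> unfolding C_loc_def by blast
  have "\<exists>k<n. p k \<noteq> 0"
    using p by (metis lessThan_iff sum.neutral zero_neq_one)
  then obtain k where k: "k < n" "p k \<noteq> 0" by blast
  have nz: "entry \<Gamma> (a, b) (x, y) \<noteq> 0"
    if "x \<in> V2" "y \<in> W1" "a \<in> V1" "b \<in> W2" "entry (\<Phi> k) a x \<noteq> 0" "entry (\<Psi> k) b y \<noteq> 0"
    for x y a b
  proof
    assume "entry \<Gamma> (a, b) (x, y) = 0"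
    moreover have "entry \<Gamma> (a, b) (x, y) =
        (\<Sum>k<n. complex_of_real (p k) * entry (tensor_map V2 W1 (\<Phi> k) (\<Psi> k)) (a, b) (x, y))"
      using that by (simp add: entry_def eq matrix_unit_diag_alg)
    ultimately have "(\<Sum>k<n. complex_of_real (p k) * (entry (\<Phi> k) a x * entry (\<Psi> k) b y)) = 0"
      using that fin by (simp add: entry_tensor_map)
    moreover have "0 \<le> complex_of_real (p j) * (entry (\<Phi> j) a x * entry (\<Psi> j) b y)" if "j < n" for j
      using ch[OF that] fin \<open>x \<in> V2\<close> \<open>y \<in> W1\<close> \<open>a \<in> V1\<close> \<open>b \<in> W2\<close>
      by (intro mult_nonneg_nonneg) (auto intro: channel_entry_nonneg complex_of_real_nonneg)
    ultimately have "complex_of_real (p k) * (entry (\<Phi> k) a x * entry (\<Psi> k) b y) = 0"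
      using k(1) by (subst (asm) sum_nonneg_eq_0_iff) auto
    then show False using k that by simp
  qed
  have "\<exists>a. a \<in> V1 \<and> entry (\<Phi> k) a x \<noteq> 0" if "x \<in> V2" for x
    using channel_entry_nonzero ch[OF k(1)] fin that by metis
  then obtain f where f: "\<And>x. x \<in> V2 \<Longrightarrow> f x \<in> V1 \<and> entry (\<Phi> k) (f x) x \<noteq> 0" by metis
  have "\<exists>b. b \<in> W2 \<and> entry (\<Psi> k) b y \<noteq> 0" if "y \<in> W1" for y
    using channel_entry_nonzero ch[OF k(1)] fin that by metis
  then obtain g where g: "\<And>y. y \<in> W1 \<Longrightarrow> g y \<in> W2 \<and> entry (\<Psi> k) (g y) y \<noteq> 0" by metis
  show thesis
  proof (rule that[of f g])
    show "(x, g y) \<in> F" if "x \<in> V2" "y \<in> W1" "(f x, y) \<in> E" for x y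
      using f g nz win that by meson
  qed (use f g in auto)
qed

section \<open>Operators on tensor products\<close>

lemma sum_mult_nat_pairs:
  fixes m n :: nat and f :: "nat \<Rightarrow> 'a :: comm_monoid_add"
  shows "(\<Sum>k<m * n. f k) = (\<Sum>(i, j)\<in>{..<m} \<times> {..<n}. f (i * n + j))"
proof -
  have "(\<Sum>k<m * n. f k) = (\<Sum>i<m. sum f {i * n..<i * n + n})"
    by (rule sum.nat_group[symmetric])
  also have "\<dots> = (\<Sum>i<m. \<Sum>j<n. f (i * n + j))"
  proof (rule sum.cong[OF refl])
    fix i
    show "sum f {i * n..<i * n + n} = (\<Sum>j<n. f (i * n + j))"
      using sum.shift_bounds_nat_ivl[of f 0 "i * n" n] by (simp add: lessThan_atLeast0 add.commute)
  qed
  finally show ?thesis by (simp add: sum.cartesian_product)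
qed

lemma pair_index_less:
  fixes i j m n :: nat
  assumes "i < m" "j < n"
  shows "i * n + j < m * n"
proof -
  have "i * n + j < Suc i * n" using assms by simp
  also have "\<dots> \<le> m * n" using assms by (intro mult_le_mono1) simp
  finally show ?thesis .
qed

lemma sesquilinear_mult_mat_vec:
  assumes "A \<in> carrier_mat d d" "x \<in> carrier_vec d"
  shows "(A *\<^sub>v x) \<bullet>c x = (\<Sum>i<d. \<Sum>j<d. A $$ (i, j) * x $ j * cnj (x $ i))"
  using assms
  by (auto simp: scalar_prod_def sum_distrib_right lessThan_atLeast0 intro!: sum.cong)

lemma kronecker_expectation:
  assumes A: "A \<in> carrier_mat m m" and B: "B \<in> carrier_mat n n" and \<xi>: "\<xi> \<in> carrier_vec (m * n)"
  shows "(kronecker A B *\<^sub>v \<xi>) \<bullet>c \<xi> =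
    (\<Sum>(i, j)\<in>{..<m} \<times> {..<n}. \<Sum>(i', j')\<in>{..<m} \<times> {..<n}.
      A $$ (i, i') * B $$ (j, j') * \<xi> $ (i' * n + j') * cnj (\<xi> $ (i * n + j)))"
proof -
  have K: "kronecker A B \<in> carrier_mat (m * n) (m * n)"
    using A B by (auto simp: kronecker_def)
  have "kronecker A B $$ (i * n + j, i' * n + j') = A $$ (i, i') * B $$ (j, j')"
    if "i < m" "j < n" "i' < m" "j' < n" for i j i' j'
    using A B that by (simp add: kronecker_def pair_index_less)
  then show ?thesis
    unfolding sesquilinear_mult_mat_vec[OF K \<xi>] sum_mult_nat_pairs
    by (intro sum.cong refl) (auto intro!: sum.cong)
qed

section \<open>Quantum correlations from a maximally entangled state\<close>

text \<open>Real symmetric projections: the expectation of A \<otimes> B in the maximally entangled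
  state is tr(A B^T)/d, and here the transpose disappears.\<close>

definition real_pvm :: "nat \<Rightarrow> 'a set \<Rightarrow> ('a \<Rightarrow> nat \<Rightarrow> nat \<Rightarrow> real) \<Rightarrow> bool" where
  "real_pvm d A P \<longleftrightarrow> finite A \<and>
     (\<forall>a\<in>A. \<forall>i<d. \<forall>j<d. P a i j = P a j i \<and> (\<Sum>k<d. P a i k * P a k j) = P a i j) \<and>
     (\<forall>i<d. \<forall>j<d. (\<Sum>a\<in>A. P a i j) = (if i = j then 1 else 0))"

text \<open>This is P = P^T P, the source of positivity both for the operators and for the traces of
  products.\<close>

lemma real_pvm_gram:
  assumes "real_pvm d A P" "a \<in> A" "i < d" "j < d"
  shows "P a i j = (\<Sum>k<d. P a k i * P a k j)"
proof -
  have "P a i j = (\<Sum>k<d. P a i k * P a k j)"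
    using assms unfolding real_pvm_def by metis
  also have "\<dots> = (\<Sum>k<d. P a k i * P a k j)"
    using assms unfolding real_pvm_def by (intro sum.cong) auto
  finally show ?thesis .
qed

lemma povm_real_pvm:
  assumes P: "real_pvm d A P"
  shows "povm d A (\<lambda>a. mat d d (\<lambda>(i, j). complex_of_real (P a i j)))"
proof -
  have "positive_op d (mat d d (\<lambda>(i, j). complex_of_real (P a i j)))" (is "positive_op d ?M")
    if a: "a \<in> A" for a
    unfolding positive_op_def
  proof (intro conjI ballI)
    fix x :: "complex vec" assume x: "x \<in> carrier_vec d"
    let ?z = "\<lambda>k j. complex_of_real (P a k j) * x $ j"
    have "(?M *\<^sub>v x) \<bullet>c x =
        (\<Sum>i<d. \<Sum>j<d. complex_of_real (P a i j) * x $ j * cnj (x $ i))"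
      using x by (subst sesquilinear_mult_mat_vec[of _ d]) auto
    also have "\<dots> = (\<Sum>i<d. \<Sum>j<d. complex_of_real (\<Sum>k<d. P a k i * P a k j) * x $ j * cnj (x $ i))"
      by (intro sum.cong refl arg_cong2[where f = times] arg_cong[where f = complex_of_real])
         (auto intro: real_pvm_gram[OF P a])
    also have "\<dots> = (\<Sum>i<d. \<Sum>j<d. \<Sum>k<d. ?z k j * cnj (?z k i))"
      by (simp add: sum_distrib_right sum_distrib_left mult_ac)
    also have "\<dots> = (\<Sum>i<d. \<Sum>k<d. \<Sum>j<d. ?z k j * cnj (?z k i))"
      by (rule sum.cong[OF refl], rule sum.swap)
    also have "\<dots> = (\<Sum>k<d. \<Sum>i<d. \<Sum>j<d. ?z k j * cnj (?z k i))"
      by (rule sum.swap)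
    also have "\<dots> = (\<Sum>k<d. (\<Sum>j<d. ?z k j) * cnj (\<Sum>j<d. ?z k j))"
      by (rule sum.cong[OF refl], subst sum.swap) (simp add: sum_product)
    finally show "0 \<le> (?M *\<^sub>v x) \<bullet>c x"
      by (simp only: sum_nonneg mult_cnj_nonneg)
  qed simp
  moreover have "mat d d (\<lambda>ij. \<Sum>a\<in>A. mat d d (\<lambda>(i, j). complex_of_real (P a i j)) $$ ij) = 1\<^sub>m d"
    using P by (auto simp: real_pvm_def simp flip: of_real_sum)
  ultimately show ?thesis
    using P by (simp add: povm_def real_pvm_def)
qed

text \<open>With P = P^T P and Q = Q^T Q the sum becomes the squared Hilbert-Schmidt norm of
  PQ.\<close>

lemma real_pvm_trace_nonneg:
  assumes P: "real_pvm d A P" "a \<in> A" and Q: "real_pvm d B Q" "b \<in> B"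
  shows "0 \<le> (\<Sum>i<d. \<Sum>j<d. P a i j * Q b i j)"
proof -
  let ?R = "\<lambda>k l i. P a k i * Q b l i"
  have "(\<Sum>i<d. \<Sum>j<d. P a i j * Q b i j) =
      (\<Sum>i<d. \<Sum>j<d. (\<Sum>k<d. P a k i * P a k j) * (\<Sum>l<d. Q b l i * Q b l j))"
    by (intro sum.cong refl arg_cong2[where f = times])
       (auto intro: real_pvm_gram[OF P] real_pvm_gram[OF Q])
  also have "\<dots> = (\<Sum>i<d. \<Sum>j<d. \<Sum>k<d. \<Sum>l<d. ?R k l i * ?R k l j)"
    by (simp add: sum_product mult_ac)
  also have "\<dots> = (\<Sum>i<d. \<Sum>k<d. \<Sum>l<d. \<Sum>j<d. ?R k l i * ?R k l j)"
    by (rule sum.cong[OF refl], subst sum.swap, rule sum.cong[OF refl], rule sum.swap)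
  also have "\<dots> = (\<Sum>k<d. \<Sum>l<d. \<Sum>i<d. \<Sum>j<d. ?R k l i * ?R k l j)"
    by (subst sum.swap, rule sum.cong[OF refl], rule sum.swap)
  also have "\<dots> = (\<Sum>k<d. \<Sum>l<d. (\<Sum>i<d. ?R k l i)\<^sup>2)"
    by (simp add: power2_eq_square sum_product)
  finally show ?thesis by (simp add: sum_nonneg)
qed

text \<open>Summing out one player turns tr(PQ)/d into the normalised trace of the other player's
  projection, which involves that player's question alone; this gives no-signalling.\<close>

lemma C_q_maximally_entangled:
  fixes P :: "'v2 \<Rightarrow> 'v1 \<Rightarrow> nat \<Rightarrow> nat \<Rightarrow> real" and Q :: "'w1 \<Rightarrow> 'w2 \<Rightarrow> nat \<Rightarrow> nat \<Rightarrow> real"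
  assumes fin: "finite V2" "finite W1" "finite V1" "finite W2" and d: "0 < d"
    and P: "\<And>x. x \<in> V2 \<Longrightarrow> real_pvm d V1 (P x)"
    and Q: "\<And>y. y \<in> W1 \<Longrightarrow> real_pvm d W2 (Q y)"
  shows "kernel_channel (V2 \<times> W1) (V1 \<times> W2)
    (\<lambda>(a, b) (x, y). (\<Sum>i<d. \<Sum>j<d. P x a i j * Q y b i j) / d) \<in> C_q V2 W1 V1 W2"
    (is "kernel_channel _ _ ?k \<in> _")
proof -
  let ?\<Gamma> = "kernel_channel (V2 \<times> W1) (V1 \<times> W2) ?k"
  have "?\<Gamma> \<in> C_ns V2 W1 V1 W2"
  proof (rule C_ns_kernel_channel[OF fin])
    show "0 \<le> ?k (a, b) (x, y)" if "x \<in> V2" "y \<in> W1" "a \<in> V1" "b \<in> W2" for x y a b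
      using real_pvm_trace_nonneg[OF P _ Q] that by simp
  next
    show "(\<Sum>b\<in>W2. ?k (a, b) (x, y)) = (\<Sum>i<d. P x a i i) / d" if "x \<in> V2" "y \<in> W1" "a \<in> V1" for x y a
    proof -
      have "(\<Sum>b\<in>W2. \<Sum>i<d. \<Sum>j<d. P x a i j * Q y b i j) =
          (\<Sum>i<d. \<Sum>j<d. P x a i j * (\<Sum>b\<in>W2. Q y b i j))"
        by (subst sum.swap, intro sum.cong refl, subst sum.swap) (simp add: sum_distrib_left)
      also have "\<dots> = (\<Sum>i<d. \<Sum>j<d. if j = i then P x a i j else 0)"
        using Q[OF \<open>y \<in> W1\<close>] by (intro sum.cong refl) (auto simp: real_pvm_def)
      finally show ?thesis by (simp flip: sum_divide_distrib)
    qed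
  next
    show "(\<Sum>a\<in>V1. ?k (a, b) (x, y)) = (\<Sum>i<d. Q y b i i) / d" if "x \<in> V2" "y \<in> W1" "b \<in> W2" for x y b
    proof -
      have "(\<Sum>a\<in>V1. \<Sum>i<d. \<Sum>j<d. P x a i j * Q y b i j) =
          (\<Sum>i<d. \<Sum>j<d. (\<Sum>a\<in>V1. P x a i j) * Q y b i j)"
        by (subst sum.swap, intro sum.cong refl, subst sum.swap) (simp add: sum_distrib_right)
      also have "\<dots> = (\<Sum>i<d. \<Sum>j<d. if j = i then Q y b i j else 0)"
        using P[OF \<open>x \<in> V2\<close>] by (intro sum.cong refl) (auto simp: real_pvm_def)
      finally show ?thesis by (simp flip: sum_divide_distrib)
    qed
  next
    show "(\<Sum>a\<in>V1. (\<Sum>i<d. P x a i i) / d) = 1" if "x \<in> V2" for x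
    proof -
      have "(\<Sum>a\<in>V1. \<Sum>i<d. P x a i i) = (\<Sum>i<d. 1)"
        using P[OF that] by (subst sum.swap) (auto simp: real_pvm_def)
      then show ?thesis using d by (simp flip: sum_divide_distrib)
    qed
  qed
  moreover define r where "r = complex_of_real (1 / sqrt d)"
  \<comment> \<open>The indices with equal quotient and remainder are those of the basis vectors e_i
    \<otimes> e_i.\<close>
  define \<xi> where "\<xi> = vec (d * d) (\<lambda>k. if k div d = k mod d then r else 0)"
  have \<xi>: "\<xi> \<in> carrier_vec (d * d)" by (simp add: \<xi>_def)
  have \<xi>_index: "\<xi> $ (i * d + j) = (if i = j then r else 0)"
    if "i < d" "j < d" for i j
    using that by (simp add: \<xi>_def pair_index_less)
  have sq: "r * cnj r = complex_of_real (1 / d)"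
    by (simp add: r_def power2_eq_square flip: of_real_mult)
  have expect: "(kronecker A B *\<^sub>v \<xi>) \<bullet>c \<xi> =
      (\<Sum>i<d. \<Sum>i'<d. A $$ (i, i') * B $$ (i, i')) * complex_of_real (1 / d)"
    if "A \<in> carrier_mat d d" "B \<in> carrier_mat d d" for A B
  proof -
    have "(kronecker A B *\<^sub>v \<xi>) \<bullet>c \<xi> =
      (\<Sum>i<d. \<Sum>j<d. if j = i then \<Sum>i'<d. \<Sum>j'<d. if j' = i' then
        A $$ (i, i') * B $$ (j, j') * complex_of_real (1 / d) else 0 else 0)"
      unfolding kronecker_expectation[OF that \<xi>]
      unfolding sum.cartesian_product[symmetric]
    proof (intro sum.cong[OF refl])
      fix i j assume ij: "i \<in> {..<d}" "j \<in> {..<d}"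
      show "(\<Sum>i'<d. \<Sum>j'<d. A $$ (i, i') * B $$ (j, j') * \<xi> $ (i' * d + j') * cnj (\<xi> $ (i * d + j))) =
        (if j = i then \<Sum>i'<d. \<Sum>j'<d. if j' = i' then
          A $$ (i, i') * B $$ (j, j') * complex_of_real (1 / d) else 0 else 0)"
      proof (cases "j = i")
        case True
        have "(\<Sum>i'<d. \<Sum>j'<d. A $$ (i, i') * B $$ (j, j') * \<xi> $ (i' * d + j') * cnj (\<xi> $ (i * d + j))) =
            (\<Sum>i'<d. \<Sum>j'<d. if j' = i' then A $$ (i, i') * B $$ (j, j') * complex_of_real (1 / d) else 0)"
          using ij True by (intro sum.cong[OF refl]) (simp add: \<xi>_index mult.assoc sq)
        then show ?thesis using True by simp
      qed (use ij in \<open>simp add: \<xi>_index\<close>)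
    qed
    then show ?thesis by (simp add: sum_divide_distrib)
  qed
  moreover have "\<xi> \<bullet>c \<xi> = 1"
  proof -
    have "\<xi> \<bullet>c \<xi> = (\<Sum>k<d * d. \<xi> $ k * cnj (\<xi> $ k))"
      using \<xi> by (auto simp: scalar_prod_def lessThan_atLeast0 intro!: sum.cong)
    also have "\<dots> = (\<Sum>i<d. \<Sum>j<d. if j = i then complex_of_real (1 / d) else 0)"
      unfolding sum_mult_nat_pairs sum.cartesian_product[symmetric]
      by (intro sum.cong refl) (auto simp: \<xi>_index sq)
    finally show ?thesis using d by simp
  qed
  moreover have "entry ?\<Gamma> (a, b) (x, y) =
      (kronecker (mat d d (\<lambda>(i, j). complex_of_real (P x a i j)))
        (mat d d (\<lambda>(i, j). complex_of_real (Q y b i j))) *\<^sub>v \<xi>) \<bullet>c \<xi>"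
    if "x \<in> V2" "y \<in> W1" "a \<in> V1" "b \<in> W2" for x y a b
    using that fin by (subst expect) (auto simp: entry_kernel_channel)
  ultimately show ?thesis
    unfolding C_q_def using \<xi> povm_real_pvm[OF P] povm_real_pvm[OF Q]
    by (auto intro!: exI[of _ d] exI[of _ \<xi>]
        exI[of _ "\<lambda>x a. mat d d (\<lambda>(i, j). complex_of_real (P x a i j))"]
        exI[of _ "\<lambda>y b. mat d d (\<lambda>(i, j). complex_of_real (Q y b i j))"])
qed

text \<open>The rank one projections r_b r_b^T / n are merged along the fibres of \<phi>.
  Orthogonality makes the merged sums idempotent, completeness makes them add up to the identity; a
  common squared length \<open>n\<close> avoids square roots.\<close>

lemma real_pvm_orthogonal_basis:
  fixes r :: "'b \<Rightarrow> nat \<Rightarrow> real"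
  assumes fin: "finite A" "finite B" and \<phi>: "\<phi> \<in> B \<rightarrow> A" and n: "n \<noteq> 0"
    and orth: "\<And>b b'. b \<in> B \<Longrightarrow> b' \<in> B \<Longrightarrow> (\<Sum>k<d. r b k * r b' k) = (if b = b' then n else 0)"
    and complete: "\<And>i j. i < d \<Longrightarrow> j < d \<Longrightarrow> (\<Sum>b\<in>B. r b i * r b j) = (if i = j then n else 0)"
  shows "real_pvm d A (\<lambda>a i j. \<Sum>b | b \<in> B \<and> \<phi> b = a. r b i * r b j / n)"
  unfolding real_pvm_def
proof (intro conjI ballI allI impI)
  fix a i j assume "a \<in> A" "i < d" "j < d"
  let ?B = "{b \<in> B. \<phi> b = a}"
  show "(\<Sum>b\<in>?B. r b i * r b j / n) = (\<Sum>b\<in>?B. r b j * r b i / n)"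
    by (simp add: mult.commute)
  have "(\<Sum>k<d. (\<Sum>b\<in>?B. r b i * r b k / n) * (\<Sum>b\<in>?B. r b k * r b j / n)) =
      (\<Sum>k<d. \<Sum>b\<in>?B. \<Sum>b'\<in>?B. r b i * r b' j / n\<^sup>2 * (r b k * r b' k))"
    by (simp add: sum_product power2_eq_square mult_ac)
  also have "\<dots> = (\<Sum>b\<in>?B. \<Sum>k<d. \<Sum>b'\<in>?B. r b i * r b' j / n\<^sup>2 * (r b k * r b' k))"
    by (rule sum.swap)
  also have "\<dots> = (\<Sum>b\<in>?B. \<Sum>b'\<in>?B. r b i * r b' j / n\<^sup>2 * (\<Sum>k<d. r b k * r b' k))"
    unfolding sum_distrib_left by (rule sum.cong[OF refl], rule sum.swap)
  also have "\<dots> = (\<Sum>b\<in>?B. \<Sum>b'\<in>?B. if b' = b then r b i * r b j / n else 0)"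
    using n by (intro sum.cong[OF refl]) (auto simp: orth power2_eq_square)
  also have "\<dots> = (\<Sum>b\<in>?B. r b i * r b j / n)"
    using fin by (intro sum.cong[OF refl]) auto
  finally show "(\<Sum>k<d. (\<Sum>b\<in>?B. r b i * r b k / n) * (\<Sum>b\<in>?B. r b k * r b j / n)) =
      (\<Sum>b\<in>?B. r b i * r b j / n)" .
next
  fix i j assume ij: "i < d" "j < d"
  have "(\<Sum>a\<in>A. \<Sum>b | b \<in> B \<and> \<phi> b = a. r b i * r b j / n) = (\<Sum>b\<in>B. r b i * r b j / n)"
    using fin \<phi> by (intro sum.group) auto
  then show "(\<Sum>a\<in>A. \<Sum>b | b \<in> B \<and> \<phi> b = a. r b i * r b j / n) = (if i = j then 1 else 0)"
    using complete[OF ij] n by (simp flip: sum_divide_distrib)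
qed (fact fin)

section \<open>The Peres-Mermin square\<close>

text \<open>The cell in row \<open>R\<close> and column \<open>C\<close> has number \<open>3 * R + C\<close>, row \<open>R\<close> is line \<open>R\<close>, and column \<open>C\<close> is line
  \<open>3 + C\<close>. The point \<open>2 * c + s\<close> is the cell \<open>c\<close> with the bit \<open>s\<close>, and the face \<open>\<beta> < 4\<close> of a line
  has the two binary digits of \<open>\<beta>\<close> and their parity as its bits.\<close>

definition pm_cell :: "nat \<Rightarrow> nat \<Rightarrow> nat" where
  "pm_cell L k = (if L < 3 then 3 * L + k else 3 * k + (L - 3))"

definition pm_bit :: "nat \<Rightarrow> nat \<Rightarrow> nat" where
  "pm_bit \<beta> k = (if k = 0 then \<beta> div 2 else if k = 1 then \<beta> mod 2 else (\<beta> div 2 + \<beta>) mod 2)"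

definition pm_face :: "nat \<Rightarrow> nat \<Rightarrow> nat set" where
  "pm_face L \<beta> = (\<lambda>k. 2 * pm_cell L k + pm_bit \<beta> k) ` {..<3}"

text \<open>The rays of Peres: \<open>pm_basis L ! \<beta>\<close> is the joint eigenvector for the face \<open>\<beta>\<close> of line \<open>L\<close> in the square
  with rows \<open>-XI, -IX, XX\<close>; \<open>IZ, ZI, ZZ\<close>; \<open>XZ, ZX, YY\<close>. The bit \<open>s\<close> stands for
  the eigenvalue \<open>(-1)^s\<close> on rows and for \<open>-(-1)^s\<close> on columns, which makes all bit sums even.\<close>

definition pm_basis :: "nat \<Rightarrow> int list list" where
  "pm_basis L =
    [[[1, -1, -1, 1], [1, 1, -1, -1], [1, -1, 1, -1], [1, 1, 1, 1]],
     [[1, 0, 0, 0], [0, 0, 1, 0], [0, 1, 0, 0], [0, 0, 0, 1]],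
     [[1, 1, 1, -1], [1, -1, 1, 1], [1, 1, -1, 1], [1, -1, -1, -1]],
     [[0, 1, 0, 1], [1, 0, 1, 0], [0, 1, 0, -1], [1, 0, -1, 0]],
     [[0, 0, 1, 1], [1, 1, 0, 0], [0, 0, 1, -1], [1, -1, 0, 0]],
     [[0, 1, -1, 0], [1, 0, 0, -1], [0, 1, 1, 0], [1, 0, 0, 1]]] ! L"

text \<open>The four rays of a line share this squared length, so integer coordinates suffice and
  one division normalises the projections.\<close>

definition pm_norm :: "nat \<Rightarrow> int" where
  "pm_norm L = [4, 1, 4, 2, 2, 2] ! L"

lemma sum_less_4: "(\<Sum>k<4. f k) = f 0 + f 1 + f 2 + f (3 :: nat)"
  by (simp add: eval_nat_numeral add.assoc)

lemma all_less_3: "(\<forall>k<3. P k) \<longleftrightarrow> P 0 \<and> P 1 \<and> P (2 :: nat)"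
  by (simp add: eval_nat_numeral All_less_Suc2)

lemma all_less_4: "(\<forall>k<4. P k) \<longleftrightarrow> P 0 \<and> P 1 \<and> P 2 \<and> P (3 :: nat)"
  by (simp add: eval_nat_numeral All_less_Suc2)

lemma all_less_6: "(\<forall>k<6. P k) \<longleftrightarrow> P 0 \<and> P 1 \<and> P 2 \<and> P 3 \<and> P 4 \<and> P (5 :: nat)"
  by (simp add: eval_nat_numeral All_less_Suc2)

lemmas pm_basis_simps = pm_basis_def[of 0, simplified] pm_basis_def[of 1, simplified]
  pm_basis_def[of 2, simplified] pm_basis_def[of 3, simplified]
  pm_basis_def[of 4, simplified] pm_basis_def[of 5, simplified]

lemma pm_norm_pos: "\<forall>L<6. pm_norm L > 0"
  unfolding all_less_6 by (simp add: pm_norm_def)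

lemma pm_basis_orthogonal:
  "\<forall>L<6. \<forall>\<beta><4. \<forall>\<gamma><4. (\<Sum>k<4. pm_basis L ! \<beta> ! k * pm_basis L ! \<gamma> ! k) =
     (if \<beta> = \<gamma> then pm_norm L else 0)"
  unfolding all_less_6 all_less_4 sum_less_4 by (simp add: pm_basis_simps pm_norm_def)

lemma pm_basis_complete:
  "\<forall>L<6. \<forall>i<4. \<forall>j<4. (\<Sum>\<beta><4. pm_basis L ! \<beta> ! i * pm_basis L ! \<beta> ! j) =
     (if i = j then pm_norm L else 0)"
  unfolding all_less_6 all_less_4 sum_less_4 by (simp add: pm_basis_simps pm_norm_def)

text \<open>Row \<open>R\<close> and column \<open>C\<close> share one cell, at position
  \<open>C\<close> of the row and position \<open>R\<close> of the column. By the opposite sign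
  conventions, equal bits there mean opposite eigenvalues of one observable, hence orthogonal
  eigenvectors.\<close>

lemma pm_basis_crossing:
  "\<forall>R<3. \<forall>C<3. \<forall>\<beta><4. \<forall>\<gamma><4. pm_bit \<beta> C = pm_bit \<gamma> R \<longrightarrow>
     (\<Sum>k<4. pm_basis R ! \<beta> ! k * pm_basis (3 + C) ! \<gamma> ! k) = 0"
  unfolding all_less_3 all_less_4 sum_less_4 by (simp add: pm_basis_simps pm_bit_def)

text \<open>The map \<phi> labels the four outcomes of a line. Bob's labelling will be injective;
  Alice's will retain only the bit of one cell.\<close>

definition pm_pvm :: "nat \<Rightarrow> (nat \<Rightarrow> 'a) \<Rightarrow> 'a \<Rightarrow> nat \<Rightarrow> nat \<Rightarrow> real" where
  "pm_pvm L \<phi> a i j = (\<Sum>\<beta> | \<beta> \<in> {..<4} \<and> \<phi> \<beta> = a.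
     real_of_int (pm_basis L ! \<beta> ! i) * real_of_int (pm_basis L ! \<beta> ! j) / real_of_int (pm_norm L))"

lemma real_pvm_pm_pvm:
  assumes "L < 6" "finite A" "\<phi> \<in> {..<4} \<rightarrow> A"
  shows "real_pvm 4 A (pm_pvm L \<phi>)"
proof -
  have "real_pvm 4 A (\<lambda>a i j. \<Sum>\<beta> | \<beta> \<in> {..<4} \<and> \<phi> \<beta> = a.
     real_of_int (pm_basis L ! \<beta> ! i) * real_of_int (pm_basis L ! \<beta> ! j) / real_of_int (pm_norm L))"
  proof (rule real_pvm_orthogonal_basis)
    show "real_of_int (pm_norm L) \<noteq> 0"
      using pm_norm_pos assms(1) by fastforce
    show "(\<Sum>k<4. real_of_int (pm_basis L ! \<beta> ! k) * real_of_int (pm_basis L ! \<gamma> ! k)) =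
        (if \<beta> = \<gamma> then real_of_int (pm_norm L) else 0)" if "\<beta> \<in> {..<4}" "\<gamma> \<in> {..<4}" for \<beta> \<gamma>
      using pm_basis_orthogonal assms(1) that by (simp flip: of_int_mult of_int_sum)
    show "(\<Sum>\<beta><4. real_of_int (pm_basis L ! \<beta> ! i) * real_of_int (pm_basis L ! \<beta> ! j)) =
        (if i = j then real_of_int (pm_norm L) else 0)" if "i < 4" "j < 4" for i j
      using pm_basis_complete assms(1) that by (simp flip: of_int_mult of_int_sum)
  qed (use assms in auto)
  then show ?thesis unfolding pm_pvm_def[abs_def] .
qed

text \<open>Up to the normalisation, the trace of the product is the sum of the squared inner
  products of the rays involved.\<close>

lemma pm_pvm_trace_zero:
  assumes "\<And>\<beta> \<gamma>. \<lbrakk>\<beta> < 4; \<gamma> < 4; \<phi> \<beta> = a; \<psi> \<gamma> = b\<rbrakk> \<Longrightarrow>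
    (\<Sum>k<4. pm_basis L ! \<beta> ! k * pm_basis M ! \<gamma> ! k) = 0"
  shows "(\<Sum>i<4. \<Sum>j<4. pm_pvm L \<phi> a i j * pm_pvm M \<psi> b i j) = 0"
proof -
  let ?B = "{\<beta> \<in> {..<4}. \<phi> \<beta> = a}" and ?C = "{\<gamma> \<in> {..<4}. \<psi> \<gamma> = b}"
  let ?t = "\<lambda>\<beta> \<gamma> i. real_of_int (pm_basis L ! \<beta> ! i) * real_of_int (pm_basis M ! \<gamma> ! i)"
  let ?n = "real_of_int (pm_norm L) * real_of_int (pm_norm M)"
  have "(\<Sum>i<4. \<Sum>j<4. pm_pvm L \<phi> a i j * pm_pvm M \<psi> b i j) =
      (\<Sum>i<4. \<Sum>j<4. \<Sum>\<beta>\<in>?B. \<Sum>\<gamma>\<in>?C. ?t \<beta> \<gamma> i * ?t \<beta> \<gamma> j / ?n)"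
    by (simp add: pm_pvm_def sum_product mult_ac)
  also have "\<dots> = (\<Sum>(i, j)\<in>{..<4} \<times> {..<4}. \<Sum>(\<beta>, \<gamma>)\<in>?B \<times> ?C. ?t \<beta> \<gamma> i * ?t \<beta> \<gamma> j / ?n)"
    by (simp only: sum.cartesian_product[symmetric])
  also have "\<dots> = (\<Sum>(\<beta>, \<gamma>)\<in>?B \<times> ?C. \<Sum>(i, j)\<in>{..<4} \<times> {..<4}. ?t \<beta> \<gamma> i * ?t \<beta> \<gamma> j / ?n)"
    unfolding case_prod_unfold by (rule sum.swap)
  also have "\<dots> = (\<Sum>(\<beta>, \<gamma>)\<in>?B \<times> ?C. (\<Sum>i<4. ?t \<beta> \<gamma> i) * (\<Sum>j<4. ?t \<beta> \<gamma> j) / ?n)"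
    by (simp only: sum_product sum.cartesian_product sum_divide_distrib case_prod_unfold)
  also have "\<dots> = 0"
    using assms by (intro sum.neutral) (auto simp flip: of_int_mult of_int_sum)
  finally show ?thesis .
qed

lemma pm_bit_less_2: "\<beta> < 4 \<Longrightarrow> pm_bit \<beta> k < 2"
  by (simp add: pm_bit_def) presburger

lemma pm_face_iff:
  assumes "\<beta> < 4"
  shows "x \<in> pm_face L \<beta> \<longleftrightarrow> (\<exists>k<3. pm_cell L k = x div 2 \<and> pm_bit \<beta> k = x mod 2)"
proof -
  have "x = 2 * pm_cell L k + pm_bit \<beta> k \<longleftrightarrow> pm_cell L k = x div 2 \<and> pm_bit \<beta> k = x mod 2" for k
    using pm_bit_less_2[OF assms, of k] by presburger
  then show ?thesis by (auto simp: pm_face_def image_iff)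
qed

lemma pm_face_row:
  assumes "x < 18" "\<beta> < 4"
  shows "x \<in> pm_face (x div 2 div 3) \<beta> \<longleftrightarrow> pm_bit \<beta> (x div 2 mod 3) = x mod 2"
proof -
  have "k < 3 \<and> pm_cell (q div 3) k = q \<longleftrightarrow> k = q mod 3" if "q < 9" for q k
  proof -
    have "q div 3 < 3" using that by (simp add: less_mult_imp_div_less)
    then show ?thesis by (simp add: pm_cell_def) presburger
  qed
  from this[of "x div 2"]
  have "k < 3 \<and> pm_cell (x div 2 div 3) k = x div 2 \<longleftrightarrow> k = x div 2 mod 3" for k
    using assms(1) by (simp add: less_mult_imp_div_less)
  then show ?thesis unfolding pm_face_iff[OF assms(2)] by metis
qed

lemma pm_face_column:
  assumes "x < 18" "\<beta> < 4"
  shows "x \<in> pm_face (3 + x div 2 mod 3) \<beta> \<longleftrightarrow> pm_bit \<beta> (x div 2 div 3) = x mod 2"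
proof -
  have "k < 3 \<and> pm_cell (3 + q mod 3) k = q \<longleftrightarrow> k = q div 3" if "q < 9" for q k
    using that by (simp add: pm_cell_def) presburger
  from this[of "x div 2"]
  have "k < 3 \<and> pm_cell (3 + x div 2 mod 3) k = x div 2 \<longleftrightarrow> k = x div 2 div 3" for k
    using assms(1) by (simp add: less_mult_imp_div_less)
  then show ?thesis unfolding pm_face_iff[OF assms(2)] by metis
qed

definition pm_incidence :: "(nat \<times> nat) set" where
  "pm_incidence = {(x, b). x < 18 \<and> b < 24 \<and> x \<in> pm_face (b div 4) (b mod 4)}"

lemma leads_q_pm: "leads_q {..<6::nat} {..<6::nat} (Id_on {..<6}) {..<18} {..<24} pm_incidence"
proof -
  \<comment> \<open>Alice measures in the basis of the row of her cell and keeps only whether the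
    cell gets the bit of \<open>x\<close>; if not, she names the column.\<close>
  define \<phi> where "\<phi> x \<beta> =
    (if x \<in> pm_face (x div 2 div 3) \<beta> then x div 2 div 3 else 3 + x div 2 mod 3)" for x \<beta> :: nat
  define P where "P x = pm_pvm (x div 2 div 3) (\<phi> x)" for x
  define Q where "Q y = pm_pvm y (\<lambda>\<beta>. 4 * y + \<beta>)" for y
  let ?k = "\<lambda>(a, b) (x, y). (\<Sum>i<4. \<Sum>j<4. P x a i j * Q y b i j) / real 4"
  let ?\<Gamma> = "kernel_channel ({..<18} \<times> {..<6}) ({..<6} \<times> {..<24}) ?k"
  have "?\<Gamma> \<in> C_q {..<18} {..<6} {..<6} {..<24}"
  proof (rule C_q_maximally_entangled)
    show "real_pvm 4 {..<6} (P x)" if "x \<in> {..<18}" for x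
      unfolding P_def using that by (intro real_pvm_pm_pvm) (auto simp: \<phi>_def)
    show "real_pvm 4 {..<24} (Q y)" if "y \<in> {..<6}" for y
      unfolding Q_def using that by (intro real_pvm_pm_pvm) auto
  qed auto
  moreover have "(\<Sum>i<4. \<Sum>j<4. P x a i j * Q a b i j) = 0"
    if x: "x < 18" and a: "a < 6" and b: "b < 24" and nF: "(x, b) \<notin> pm_incidence" for x a b
    unfolding P_def Q_def
  proof (rule pm_pvm_trace_zero)
    fix \<beta> \<gamma> assume \<beta>: "\<beta> < 4" "\<phi> x \<beta> = a" and \<gamma>: "\<gamma> < (4 :: nat)" "4 * a + \<gamma> = b"
    have "b div 4 = a" "b mod 4 = \<gamma>" using \<gamma> by auto
    then have nx: "x \<notin> pm_face a \<gamma>" using x b nF by (simp add: pm_incidence_def)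
    \<comment> \<open>If Alice names the row, \<open>x\<close> lies on face \<beta> but not on face
      \<gamma> of that row, and distinct rays of one basis are orthogonal. If she names the column,
      both bits at the cell differ from that of \<open>x\<close>, so they agree and the crossing
      lemma applies.\<close>
    show "(\<Sum>k<4. pm_basis (x div 2 div 3) ! \<beta> ! k * pm_basis a ! \<gamma> ! k) = 0"
    proof (cases "x \<in> pm_face (x div 2 div 3) \<beta>")
      case True
      then have "a = x div 2 div 3" "\<beta> \<noteq> \<gamma>" using \<beta> nx by (auto simp: \<phi>_def)
      then show ?thesis using pm_basis_orthogonal a \<beta> \<gamma> by simp
    next
      case False
      then have a': "a = 3 + x div 2 mod 3" using \<beta> by (simp add: \<phi>_def)
      have "pm_bit \<beta> (x div 2 mod 3) \<noteq> x mod 2" "pm_bit \<gamma> (x div 2 div 3) \<noteq> x mod 2"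
        using False nx x \<beta> \<gamma> by (simp_all add: pm_face_row pm_face_column a')
      then have "pm_bit \<beta> (x div 2 mod 3) = pm_bit \<gamma> (x div 2 div 3)"
        using pm_bit_less_2[OF \<beta>(1), of "x div 2 mod 3"] pm_bit_less_2[OF \<gamma>(1), of "x div 2 div 3"]
        by linarith
      moreover have "x div 2 div 3 < 3" "x div 2 mod 3 < 3" using x by auto
      ultimately show ?thesis using pm_basis_crossing \<beta>(1) \<gamma>(1) unfolding a' by blast
    qed
  qed
  then have "entry ?\<Gamma> (a, b) (x, a) = 0"
    if "x < 18" "a < 6" "b < 24" "(x, b) \<notin> pm_incidence" for x a b
    using that by (simp add: entry_kernel_channel)
  ultimately show ?thesis
    unfolding leads_q_def leads_via_def by (intro bexI[where x = ?\<Gamma>]) auto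
qed

text \<open>The sum of a set of points \<open>2 * c + s\<close> has the parity of its bit sum.\<close>

lemma not_leads_loc_pm:
  "\<not> leads_loc {..<6::nat} {..<6::nat} (Id_on {..<6}) {..<18} {..<24} pm_incidence"
proof
  assume leads: "leads_loc {..<6::nat} {..<6::nat} (Id_on {..<6}) {..<18} {..<24} pm_incidence"
  obtain f g where f: "f \<in> {..<18} \<rightarrow> {..<6::nat}" and "g \<in> {..<6} \<rightarrow> {..<24::nat}" and
    fg: "\<And>x y. x \<in> {..<18} \<Longrightarrow> y \<in> {..<6} \<Longrightarrow> (f x, y) \<in> Id_on {..<6} \<Longrightarrow> (x, g y) \<in> pm_incidence"
    by (rule leads_loc_deterministic[OF finite_lessThan finite_lessThan finite_lessThan
          finite_lessThan leads])
       (rule that)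
  define h where "h = (\<lambda>(y, k). 2 * pm_cell (g y div 4) k + pm_bit (g y mod 4) k)"
  let ?D = "{..<6::nat} \<times> {..<3::nat}"
  have "x \<in> h ` ?D" if x: "x < 18" for x
  proof -
    have "f x < 6" using f x by auto
    moreover from this have "(x, g (f x)) \<in> pm_incidence" using x by (intro fg) auto
    then obtain k where "k < 3" "x = 2 * pm_cell (g (f x) div 4) k + pm_bit (g (f x) mod 4) k"
      by (auto simp: pm_incidence_def pm_face_def)
    ultimately show ?thesis by (intro image_eqI[of _ _ "(f x, k)"]) (auto simp: h_def)
  qed
  then have sub: "{..<18} \<subseteq> h ` ?D" by auto
  \<comment> \<open>The six chosen faces offer eighteen places for eighteen points, so covering
    forces \<open>h\<close> to be a bijection. Each face has an even sum, but 0 + ... + 17 = 153 is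
    odd.\<close>
  have "card ?D = 18" by simp
  moreover have "card (h ` ?D) \<le> card ?D" by (rule card_image_le) simp
  ultimately have card: "card (h ` ?D) = card ?D" "{..<18} = h ` ?D"
    using card_mono[OF _ sub] card_seteq[OF _ sub] by auto
  then have "inj_on h ?D" by (intro eq_card_imp_inj_on) simp
  then have "(\<Sum>x<18. x) = (\<Sum>p\<in>?D. h p)"
    unfolding card(2) by (simp add: sum.reindex)
  also have "\<dots> = (\<Sum>y<6. \<Sum>k<3. h (y, k))"
    by (simp add: sum.cartesian_product)
  finally have "(\<Sum>x<18. x) = (\<Sum>y<6. \<Sum>k<3. h (y, k))" .
  moreover have "even (\<Sum>k<3. h (y, k))" for y
  proof -
    have "(\<Sum>k<3. h (y, k)) = 2 * (\<Sum>k<3. pm_cell (g y div 4) k) + (\<Sum>k<3. pm_bit (g y mod 4) k)"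
      by (simp add: h_def sum.distrib sum_distrib_left)
    moreover have "even (\<Sum>k<3. pm_bit \<beta> k)" for \<beta>
    proof -
      have "(\<Sum>k<3. pm_bit \<beta> k) = \<beta> div 2 + \<beta> mod 2 + (\<beta> div 2 + \<beta>) mod 2"
        by (simp add: pm_bit_def eval_nat_numeral)
      then show ?thesis by presburger
    qed
    ultimately show ?thesis by simp
  qed
  then have "even (\<Sum>y<6. \<Sum>k<3. h (y, k))" by (rule dvd_sum)
  moreover have "(\<Sum>x<18. x) = (153 :: nat)" by (simp add: eval_nat_numeral)
  ultimately show False by simp
qed

section \<open>Positive matrices as Gram matrices\<close>

lemma positive_imat_two:
  assumes "finite I" "positive_imat I M" "i \<in> I" "j \<in> I" "i \<noteq> j"
  shows "0 \<le> M i i * (a * cnj a) + M i j * (b * cnj a) + M j i * (a * cnj b) + M j j * (b * cnj b)"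
proof -
  let ?x = "\<lambda>k. if k = i then a else if k = j then b else 0"
  have sup: "(\<Sum>k\<in>I. f k) = f i + f j" if "\<And>k. k \<noteq> i \<Longrightarrow> k \<noteq> j \<Longrightarrow> f k = 0" for f :: "'a \<Rightarrow> complex"
  proof -
    have "(\<Sum>k\<in>I. f k) = (\<Sum>k\<in>{i, j}. f k)"
      using assms that by (intro sum.mono_neutral_right) auto
    then show ?thesis using assms by simp
  qed
  have "0 \<le> (\<Sum>k\<in>I. \<Sum>l\<in>I. M k l * ?x l * cnj (?x k))"
    using assms(2) unfolding positive_imat_def by (elim allE[where x = ?x])
  also have "\<dots> = (\<Sum>k\<in>I. M k i * a * cnj (?x k) + M k j * b * cnj (?x k))"
    using assms(5) by (intro sum.cong refl) (subst sup, auto)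
  also have "\<dots> = M i i * (a * cnj a) + M i j * (b * cnj a) + M j i * (a * cnj b) + M j j * (b * cnj b)"
    using assms(5) by (subst sup) (auto simp: algebra_simps)
  finally show ?thesis .
qed

lemma positive_imat_diagonal:
  assumes "finite I" "positive_imat I M" "i \<in> I"
  shows "0 \<le> M i i"
proof -
  have "0 \<le> (\<Sum>k\<in>I. \<Sum>l\<in>I. M k l * (if l = i then 1 else 0) * cnj (if k = i then 1 else 0))"
    using assms(2) unfolding positive_imat_def
    by (elim allE[where x = "\<lambda>k. if k = i then 1 else 0"])
  also have "\<dots> = (\<Sum>k\<in>I. if k = i then \<Sum>l\<in>I. if l = i then M i i else 0 else 0)"
    by (intro sum.cong refl) (auto intro!: sum.cong)
  finally show ?thesis using assms by simp
qed

lemma positive_imat_hermitian: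
  assumes "finite I" "positive_imat I M" "i \<in> I" "j \<in> I"
  shows "M j i = cnj (M i j)"
proof (cases "i = j")
  case True
  then show ?thesis
    using positive_imat_diagonal[OF assms(1-3)] by (simp add: less_eq_complex_def complex_eq_iff)
next
  case False
  note two = positive_imat_two[OF assms False]
  have "Im (M i i) = 0" "Im (M j j) = 0"
    using positive_imat_diagonal[OF assms(1,2)] assms(3,4) by (auto simp: less_eq_complex_def)
  \<comment> \<open>The vector (1, 1) compares the imaginary parts of the two entries, the vector
    (1, \<i>) their real parts.\<close>
  then show ?thesis
    using two[of 1 1] two[of 1 \<i>] by (simp add: less_eq_complex_def complex_eq_iff)
qed

lemma positive_imat_zero_diagonal:
  assumes "finite I" "positive_imat I M" "i \<in> I" "j \<in> I" "M j j = 0"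
  shows "M i j = 0"
proof (rule ccontr)
  assume nz: "M i j \<noteq> 0"
  then have "i \<noteq> j" using assms(5) by auto
  define N where "N = (cmod (M i j))\<^sup>2"
  \<comment> \<open>This scaling makes the real part of the form at the vector (1, -t cnj(M_ij))
    equal to -1.\<close>
  define t where "t = (Re (M i i) + 1) / (2 * N)"
  have N: "N > 0" using nz by (simp add: N_def)
  have mm: "M i j * cnj (M i j) = complex_of_real N"
    unfolding N_def by (rule complex_norm_square[symmetric])
  have "0 \<le> M i i + M i j * (- complex_of_real t * cnj (M i j)) +
      M j i * cnj (- complex_of_real t * cnj (M i j))"
    using positive_imat_two[OF assms(1-4) \<open>i \<noteq> j\<close>, of 1 "- complex_of_real t * cnj (M i j)"] assms(5)
    by simp
  also have "\<dots> = M i i - complex_of_real (2 * t) * (M i j * cnj (M i j))"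
    by (simp add: positive_imat_hermitian[OF assms(1-4)])
  also have "\<dots> = M i i - complex_of_real (2 * t * N)"
    by (simp add: mm)
  also have "2 * t * N = Re (M i i) + 1"
    using N by (simp add: t_def)
  finally show False by (simp add: less_eq_complex_def)
qed

text \<open>Cholesky elimination of one index at a time.\<close>

lemma positive_imat_gram:
  assumes "finite I" "positive_imat I M"
  shows "\<exists>c :: 'a \<Rightarrow> 'a \<Rightarrow> complex. \<forall>i\<in>I. \<forall>j\<in>I. M i j = (\<Sum>k\<in>I. c k i * cnj (c k j))"
  using assms
proof (induction I arbitrary: M rule: finite_induct)
  case (insert e I)
  have herm: "cnj (M i e) = M e i" if "i \<in> insert e I" for i
    using positive_imat_hermitian[OF finite.insertI[OF insert.hyps(1)] insert.prems that, of e] by simp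
  obtain q where q: "M e e = complex_of_real q" "0 \<le> q"
    using positive_imat_diagonal[OF finite.insertI[OF insert.hyps(1)] insert.prems, of e]
    by (metis insertI1 less_eq_complex_def complex_eq_iff
        Im_complex_of_real Re_complex_of_real zero_complex.sel)
  \<comment> \<open>The Schur complement of the pivot \<open>q\<close>. For \<open>q = 0\<close> the
    quotient is 0 by convention, which is right because the column of \<open>e\<close> then
    vanishes; \<open>Mq\<close> records this.\<close>
  define M' where "M' i j = M i j - M i e * M e j / complex_of_real q" for i j
  have Mq: "M i e * complex_of_real q / complex_of_real q = M i e" if "i \<in> insert e I" for i
    using positive_imat_zero_diagonal[OF finite.insertI[OF insert.hyps(1)] insert.prems, of i e] that q
    by (cases "q = 0") auto
  have "positive_imat I M'"
    unfolding positive_imat_def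
  proof
    fix x :: "'a \<Rightarrow> complex"
    define s where "s = (\<Sum>j\<in>I. M e j * x j)"
    \<comment> \<open>Completing the square: with this coordinate at \<open>e\<close>, the form of
      \<open>M\<close> equals the form of \<open>M'\<close> at \<open>x\<close>.\<close>
    define y where "y = - (s / complex_of_real q)"
    let ?x = "x(e := y)"
    have "cnj (M e i) = M i e" if "i \<in> I" for i
      using herm[of i] that by (metis complex_cnj_cnj insertI2)
    then have s': "cnj s = (\<Sum>i\<in>I. M i e * cnj (x i))"
      by (simp add: s_def)
    have "0 \<le> (\<Sum>i\<in>insert e I. \<Sum>j\<in>insert e I. M i j * ?x j * cnj (?x i))"
      using insert.prems unfolding positive_imat_def by blast
    also have "\<dots> = (\<Sum>j\<in>insert e I. M e j * ?x j * cnj y) +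
        (\<Sum>i\<in>I. \<Sum>j\<in>insert e I. M i j * ?x j * cnj (?x i))"
      using insert.hyps by simp
    also have "(\<Sum>j\<in>insert e I. M e j * ?x j * cnj y) = M e e * y * cnj y + (\<Sum>j\<in>I. M e j * x j * cnj y)"
      using insert.hyps by (auto intro!: sum.cong)
    also have "(\<Sum>j\<in>I. M e j * x j * cnj y) = s * cnj y"
      by (simp add: s_def sum_distrib_right)
    also have "(\<Sum>i\<in>I. \<Sum>j\<in>insert e I. M i j * ?x j * cnj (?x i)) =
        (\<Sum>i\<in>I. M i e * y * cnj (x i) + (\<Sum>j\<in>I. M i j * x j * cnj (x i)))"
      using insert.hyps by (intro sum.cong refl) (auto intro!: sum.cong)
    also have "\<dots> = cnj s * y + (\<Sum>i\<in>I. \<Sum>j\<in>I. M i j * x j * cnj (x i))"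
      by (simp add: sum.distrib s' sum_distrib_left sum_distrib_right mult_ac)
    also have "M e e * y * cnj y + s * cnj y + (cnj s * y + (\<Sum>i\<in>I. \<Sum>j\<in>I. M i j * x j * cnj (x i))) =
        (\<Sum>i\<in>I. \<Sum>j\<in>I. M i j * x j * cnj (x i)) - cnj s * s / complex_of_real q"
      unfolding q(1) y_def by (cases "q = 0") (auto simp: field_simps)
    also have "cnj s * s / complex_of_real q =
        (\<Sum>i\<in>I. \<Sum>j\<in>I. M i e * M e j / complex_of_real q * x j * cnj (x i))"
      unfolding s' unfolding s_def by (simp add: sum_product sum_divide_distrib mult_ac) (rule sum.swap)
    finally show "0 \<le> (\<Sum>i\<in>I. \<Sum>j\<in>I. M' i j * x j * cnj (x i))"
      by (simp add: M'_def algebra_simps sum_subtractf)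
  qed
  then obtain c :: "'a \<Rightarrow> 'a \<Rightarrow> complex" where
    c: "\<And>i j. i \<in> I \<Longrightarrow> j \<in> I \<Longrightarrow> M' i j = (\<Sum>k\<in>I. c k i * cnj (c k j))"
    using insert.IH by blast
  \<comment> \<open>The pivot contributes the factor row M_ie / sqrt q; the rows for
    \<open>M'\<close> are extended by 0 at \<open>e\<close>.\<close>
  define c' where "c' k i =
    (if k = e then M i e / complex_of_real (sqrt q) else if i = e then 0 else c k i)" for k i
  have sqrtq: "complex_of_real (sqrt q) * complex_of_real (sqrt q) = complex_of_real q"
    using q(2) by (simp flip: of_real_mult)
  have "M i j = (\<Sum>k\<in>insert e I. c' k i * cnj (c' k j))"
    if i: "i \<in> insert e I" and j: "j \<in> insert e I" for i j
  proof -
    have "(\<Sum>k\<in>insert e I. c' k i * cnj (c' k j)) =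
        M i e * M e j / complex_of_real q + (\<Sum>k\<in>I. c' k i * cnj (c' k j))"
      using insert.hyps herm[OF j] by (simp add: c'_def sqrtq)
    also have "(\<Sum>k\<in>I. c' k i * cnj (c' k j)) = (if i = e \<or> j = e then 0 else M' i j)"
      using insert.hyps i j c by (auto simp: c'_def intro!: sum.cong sum.neutral)
    also have "M i e * M e j / complex_of_real q + \<dots> = M i j"
      using Mq[OF i] Mq[OF j] herm[OF j] herm[OF i] q(1)
      by (cases "i = e"; cases "j = e") (auto simp: M'_def mult_ac)
    finally show ?thesis ..
  qed
  then show ?case by blast
qed simp

text \<open>The form is the sum of all |z_k|^2, where z is the image of x under one Gram factor; if
  it vanishes, so does z, and applying the other factor gives T x = 0.\<close>

lemma gram_form_zero:
  fixes T :: "'p \<Rightarrow> 'p \<Rightarrow> complex"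
  assumes "finite K"
    and T: "\<And>p q. p \<in> P \<Longrightarrow> q \<in> P \<Longrightarrow> T p q = (\<Sum>k\<in>K. c k p * cnj (c k q))"
    and zero: "(\<Sum>p\<in>P. \<Sum>q\<in>P. T p q * x q * cnj (x p)) = 0"
    and "p \<in> P"
  shows "(\<Sum>q\<in>P. T p q * x q) = 0"
proof -
  define z where "z k = (\<Sum>q\<in>P. cnj (c k q) * x q)" for k
  have T': "(\<Sum>q\<in>P. T p q * x q) = (\<Sum>k\<in>K. c k p * z k)" if "p \<in> P" for p
  proof -
    have "(\<Sum>q\<in>P. T p q * x q) = (\<Sum>q\<in>P. \<Sum>k\<in>K. c k p * (cnj (c k q) * x q))"
      using that by (intro sum.cong refl) (simp add: T sum_distrib_right mult.assoc)
    then show ?thesis unfolding z_def sum_distrib_left by (subst sum.swap) simp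
  qed
  have "0 = (\<Sum>p\<in>P. (\<Sum>q\<in>P. T p q * x q) * cnj (x p))"
    using zero by (simp add: sum_distrib_right)
  also have "\<dots> = (\<Sum>p\<in>P. \<Sum>k\<in>K. z k * (c k p * cnj (x p)))"
    by (rule sum.cong[OF refl], subst T') (simp_all add: sum_distrib_left sum_distrib_right mult_ac)
  also have "\<dots> = (\<Sum>k\<in>K. z k * cnj (z k))"
    by (subst sum.swap) (simp add: z_def sum_distrib_left)
  finally have "\<forall>k\<in>K. z k * cnj (z k) = 0"
    using assms(1) by (subst (asm) eq_commute, subst (asm) sum_nonneg_eq_0_iff)
      (auto simp: mult_cnj_nonneg simp del: complex_cnj_mult mult_eq_0_iff)
  then have "\<forall>k\<in>K. z k = 0" by auto
  then show ?thesis using assms(4) by (simp add: T')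
qed

lemma positive_imat_positive_op:
  assumes "positive_op d A"
  shows "positive_imat {..<d} (\<lambda>i j. A $$ (i, j))"
  unfolding positive_imat_def
proof
  fix x :: "nat \<Rightarrow> complex"
  have "(A *\<^sub>v vec d x) \<bullet>c vec d x = (\<Sum>i<d. \<Sum>j<d. A $$ (i, j) * x j * cnj (x i))"
    using assms by (subst sesquilinear_mult_mat_vec[of _ d]) (auto simp: positive_op_def)
  then show "0 \<le> (\<Sum>i<d. \<Sum>j<d. A $$ (i, j) * x j * cnj (x i))"
    using assms unfolding positive_op_def by (metis vec_carrier)
qed

text \<open>Products of Gram factors of \<open>A\<close> and \<open>B\<close> are Gram factors of A
  \<otimes> B, so a vanishing expectation forces (A \<otimes> B) \<xi> = 0, stated here by
  coordinates.\<close>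

lemma kronecker_expectation_zero:
  assumes A: "positive_op m A" and B: "positive_op n B" and \<xi>: "\<xi> \<in> carrier_vec (m * n)"
    and zero: "(kronecker A B *\<^sub>v \<xi>) \<bullet>c \<xi> = 0" and ij: "i < m" "j < n"
  shows "(\<Sum>i'<m. \<Sum>j'<n. A $$ (i, i') * B $$ (j, j') * \<xi> $ (i' * n + j')) = 0"
proof -
  obtain r where r: "\<And>i j. i < m \<Longrightarrow> j < m \<Longrightarrow> A $$ (i, j) = (\<Sum>k<m. r k i * cnj (r k j))"
    using positive_imat_gram[OF _ positive_imat_positive_op[OF A]] by fastforce
  obtain s where s: "\<And>i j. i < n \<Longrightarrow> j < n \<Longrightarrow> B $$ (i, j) = (\<Sum>k<n. s k i * cnj (s k j))"
    using positive_imat_gram[OF _ positive_imat_positive_op[OF B]] by fastforce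
  let ?I = "{..<m} \<times> {..<n}"
  let ?T = "\<lambda>p q. A $$ (fst p, fst q) * B $$ (snd p, snd q)"
  let ?x = "\<lambda>p. \<xi> $ (fst p * n + snd p)"
  have "?T p q =
      (\<Sum>k\<in>?I. (r (fst k) (fst p) * s (snd k) (snd p)) * cnj (r (fst k) (fst q) * s (snd k) (snd q)))"
    if "p \<in> ?I" "q \<in> ?I" for p q
    using that by (auto simp: r s sum_product sum.cartesian_product mult_ac intro!: sum.cong)
  moreover have "(\<Sum>p\<in>?I. \<Sum>q\<in>?I. ?T p q * ?x q * cnj (?x p)) = 0"
    using zero kronecker_expectation[OF _ _ \<xi>, of A B] A B by (simp add: positive_op_def case_prod_unfold)
  ultimately have "(\<Sum>q\<in>?I. ?T (i, j) q * ?x q) = 0"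
    using ij by (intro gram_form_zero[where K = ?I
          and c = "\<lambda>k p. r (fst k) (fst p) * s (snd k) (snd p)"]) auto
  then show ?thesis by (simp add: sum.cartesian_product case_prod_unfold)
qed

section \<open>Quantum covers by two faces\<close>

lemma povm_sum:
  assumes "povm d A P" "i < d" "j < d"
  shows "(\<Sum>a\<in>A. P a $$ (i, j)) = (if i = j then 1 else 0)"
proof -
  have "mat d d (\<lambda>ij. \<Sum>a\<in>A. P a $$ ij) $$ (i, j) = 1\<^sub>m d $$ (i, j)"
    using assms(1) by (simp add: povm_def)
  then show ?thesis using assms(2,3) by simp
qed

lemma not_leads_q_two_faces:
  fixes F :: "('x \<times> 'b) set"
  assumes fin: "finite V2" "finite W2"
    and uncovered: "\<And>b b'. b \<in> W2 \<Longrightarrow> b' \<in> W2 \<Longrightarrow> \<exists>x\<in>V2. (x, b) \<notin> F \<and> (x, b') \<notin> F"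
  shows "\<not> leads_q {..<2::nat} {..<2::nat} (Id_on {..<2}) V2 W2 F"
proof
  assume "leads_q {..<2::nat} {..<2::nat} (Id_on {..<2}) V2 W2 F"
  then obtain \<Gamma> where \<Gamma>: "\<Gamma> \<in> C_q V2 {..<2} {..<2} W2" and
    win: "\<And>x a b. \<lbrakk>a < 2; x \<in> V2; b \<in> W2; (x, b) \<notin> F\<rbrakk> \<Longrightarrow> entry \<Gamma> (a :: nat, b) (x, a) = 0"
    unfolding leads_q_def leads_via_def by (metis Id_onI lessThan_iff)
  obtain m n P Q \<xi> where
    P: "\<And>x. x \<in> V2 \<Longrightarrow> povm m {..<2} (P x)" and
    Q: "\<And>y. y < 2 \<Longrightarrow> povm n W2 (Q y)" and
    \<xi>: "\<xi> \<in> carrier_vec (m * n)" "\<xi> \<bullet>c \<xi> = 1" and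
    entry: "\<And>x y a b. \<lbrakk>x \<in> V2; y < 2; a < 2; b \<in> W2\<rbrakk> \<Longrightarrow>
      entry \<Gamma> (a, b) (x, y) = (kronecker (P x a) (Q y b) *\<^sub>v \<xi>) \<bullet>c \<xi>"
    using \<Gamma> unfolding C_q_def mem_Collect_eq Ball_def lessThan_iff by blast
  \<comment> \<open>\<open>U a b\<close> is the vector (I \<otimes> Q_ab) \<xi>, with its index
    split into a pair.\<close>
  define U where "U a b i j = (\<Sum>j'<n. Q a b $$ (j, j') * \<xi> $ (i * n + j'))" for a b i j
  have U_total: "(\<Sum>b\<in>W2. U a b i j) = \<xi> $ (i * n + j)" if "a < 2" "i < m" "j < n" for a i j
  proof -
    have "(\<Sum>b\<in>W2. U a b i j) = (\<Sum>j'<n. (\<Sum>b\<in>W2. Q a b $$ (j, j')) * \<xi> $ (i * n + j'))"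
      unfolding U_def sum_distrib_right by (rule sum.swap)
    also have "\<dots> = (\<Sum>j'<n. if j' = j then \<xi> $ (i * n + j') else 0)"
      using povm_sum[OF Q[OF \<open>a < 2\<close>] \<open>j < n\<close>] by (intro sum.cong refl) auto
    finally show ?thesis using \<open>j < n\<close> by simp
  qed
  have PU: "(\<Sum>i'<m. P x a $$ (i, i') * U a b i' j) = 0"
    if "x \<in> V2" "a < 2" "b \<in> W2" "(x, b) \<notin> F" "i < m" "j < n" for x a b i j
  proof -
    have "positive_op m (P x a)" "positive_op n (Q a b)"
      using P Q that unfolding povm_def by auto
    then have "(\<Sum>i'<m. \<Sum>j'<n. P x a $$ (i, i') * Q a b $$ (j, j') * \<xi> $ (i' * n + j')) = 0"
      using that win[of a x b] entry[of x a a b] \<xi>(1) by (intro kronecker_expectation_zero) auto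
    then show ?thesis by (simp add: U_def sum_distrib_left mult.assoc)
  qed
  \<comment> \<open>For \<open>x\<close> in neither face, \<open>P x 0\<close> annihilates
    \<open>U 0 b\<close> and \<open>P x 1\<close> annihilates \<open>U 1 b'\<close>. Since the two
    operators sum to the identity, \<open>P x 0\<close> fixes \<open>U 1 b'\<close>; being
    hermitian, it can be moved across the scalar product.\<close>
  have orth: "(\<Sum>j<n. \<Sum>i<m. U 1 b' i j * cnj (U 0 b i j)) = 0" if b: "b \<in> W2" "b' \<in> W2" for b b'
  proof -
    obtain x where x: "x \<in> V2" "(x, b) \<notin> F" "(x, b') \<notin> F" using uncovered[OF b] by blast
    have "(\<Sum>i<m. U 1 b' i j * cnj (U 0 b i j)) = 0" if j: "j < n" for j
    proof -
      have P0: "positive_op m (P x 0)" using P[OF x(1)] by (simp add: povm_def)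
      have herm: "cnj (P x 0 $$ (i', i)) = P x 0 $$ (i, i')" if "i < m" "i' < m" for i i'
        using positive_imat_hermitian[OF _ positive_imat_positive_op[OF P0], of i' i] that by simp
      have "(\<Sum>i'<m. P x 0 $$ (i, i') * U 1 b' i' j) = U 1 b' i j" if i: "i < m" for i
      proof -
        have "P x 0 $$ (i, i') = (if i = i' then 1 else 0) - P x 1 $$ (i, i')" if "i' < m" for i'
          using povm_sum[OF P[OF x(1)] i that] by (simp add: numeral_2_eq_2 algebra_simps)
        then have "(\<Sum>i'<m. P x 0 $$ (i, i') * U 1 b' i' j) =
            (\<Sum>i'<m. (if i' = i then U 1 b' i' j else 0) - P x 1 $$ (i, i') * U 1 b' i' j)"
          by (intro sum.cong refl) (auto simp: left_diff_distrib)
        then show ?thesis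
          using PU[of x 1 b' i j] x b i j by (simp add: sum_subtractf)
      qed
      then have "(\<Sum>i<m. U 1 b' i j * cnj (U 0 b i j)) =
          (\<Sum>i<m. \<Sum>i'<m. P x 0 $$ (i, i') * U 1 b' i' j * cnj (U 0 b i j))"
        by (simp flip: sum_distrib_right)
      also have "\<dots> = (\<Sum>i'<m. \<Sum>i<m. P x 0 $$ (i, i') * U 1 b' i' j * cnj (U 0 b i j))"
        by (rule sum.swap)
      also have "\<dots> = (\<Sum>i'<m. U 1 b' i' j * cnj (\<Sum>i<m. P x 0 $$ (i', i) * U 0 b i j))"
        unfolding cnj_sum sum_distrib_left by (intro sum.cong refl) (simp add: herm mult_ac)
      also have "\<dots> = 0"
        using PU[of x 0 b _ j] x b j by simp
      finally show ?thesis .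
    qed
    then show ?thesis by simp
  qed
  \<comment> \<open>One copy of \<xi> is expanded by Bob's measurement for colour 1, the other by
    that for colour 0.\<close>
  have "1 = (\<Sum>k<m * n. \<xi> $ k * cnj (\<xi> $ k))"
    unfolding \<xi>(2)[symmetric] using \<xi>(1)
    by (auto simp: scalar_prod_def lessThan_atLeast0 intro!: sum.cong)
  also have "\<dots> = (\<Sum>i<m. \<Sum>j<n. (\<Sum>b'\<in>W2. U 1 b' i j) * cnj (\<Sum>b\<in>W2. U 0 b i j))"
    unfolding sum_mult_nat_pairs sum.cartesian_product[symmetric] by (simp add: U_total)
  also have "\<dots> = (\<Sum>j<n. \<Sum>i<m. \<Sum>b'\<in>W2. \<Sum>b\<in>W2. U 1 b' i j * cnj (U 0 b i j))"
    by (subst sum.swap) (simp add: sum_product)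
  also have "\<dots> = (\<Sum>j<n. \<Sum>b'\<in>W2. \<Sum>b\<in>W2. \<Sum>i<m. U 1 b' i j * cnj (U 0 b i j))"
    by (rule sum.cong[OF refl], subst sum.swap, rule sum.cong[OF refl], rule sum.swap)
  also have "\<dots> = (\<Sum>b'\<in>W2. \<Sum>b\<in>W2. \<Sum>j<n. \<Sum>i<m. U 1 b' i j * cnj (U 0 b i j))"
    by (subst sum.swap, rule sum.cong[OF refl], rule sum.swap)
  also have "\<dots> = 0" using orth by simp
  finally show False by simp
qed

section \<open>The triangles of \<open>K\<^sub>4\<close>\<close>

text \<open>An edge is determined by the two triangles through it; the edges 0 to 5 belong to the
  pairs 01, 02, 03, 12, 13, 23 of triangles.\<close>

definition K4_edge_triangle :: "(nat \<times> nat) set" where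
  "K4_edge_triangle = {(0,0), (1,0), (2,0), (0,1), (3,1), (4,1),
    (1,2), (3,2), (5,2), (2,3), (4,3), (5,3)}"

lemma lessThan_6: "{..<6} = {0, 1, 2, 3, 4, 5 :: nat}"
  by auto

lemma lessThan_4: "{..<4} = {0, 1, 2, 3 :: nat}"
  by auto

text \<open>For two distinct triangles, the common edge of the other two lies in neither.\<close>

lemma K4_uncovered:
  assumes "b \<in> {..<4}" "b' \<in> {..<4}"
  shows "\<exists>x\<in>{..<6}. (x, b) \<notin> K4_edge_triangle \<and> (x, b') \<notin> K4_edge_triangle"
proof -
  have "\<forall>b\<in>{..<4}. \<forall>b'\<in>{..<4}. \<exists>x\<in>{..<6}. (x, b) \<notin> K4_edge_triangle \<and> (x, b') \<notin> K4_edge_triangle"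
    unfolding lessThan_6 lessThan_4 K4_edge_triangle_def by simp
  then show ?thesis using assms by blast
qed

lemma leads_ns_K4:
  "leads_ns {..<2::nat} {..<2::nat} (Id_on {..<2}) {..<6} {..<4} K4_edge_triangle"
proof -
  \<comment> \<open>Bob's triangle is uniform among the four. Alice answers with his colour exactly
    when it contains her edge; two triangles do and two do not, so each colour has probability
    1/2.\<close>
  let ?k = "\<lambda>(a :: nat, b) (x, y). if ((x, b) \<in> K4_edge_triangle) = (a = y) then 1 / 4 else 0 :: real"
  let ?\<Gamma> = "kernel_channel ({..<6} \<times> {..<2}) ({..<2} \<times> {..<4}) ?k"
  have "?\<Gamma> \<in> C_ns {..<6} {..<2} {..<2} {..<4}"
  proof (rule C_ns_kernel_channel)
    show "(\<Sum>b<4. ?k (a, b) (x, y)) = 1 / 2" if "x \<in> {..<6}" for x y a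
      using that unfolding lessThan_6 lessThan_4
      by (elim insertE emptyE) (simp_all add: K4_edge_triangle_def)
    show "(\<Sum>a<2. ?k (a, b) (x, y)) = 1 / 4" if "y \<in> {..<2}" for x y b
      using that by (auto simp: numeral_2_eq_2 less_Suc_eq)
  qed auto
  then show ?thesis
    unfolding leads_ns_def leads_via_def
    by (rule bexI[rotated]) (auto simp: entry_kernel_channel)
qed

section \<open>Strictness of the implications\<close>

theorem proposition3p6:
  shows "(\<exists>(V1 :: nat set) (W1 :: nat set) E (V2 :: nat set) (W2 :: nat set) F.
            proper_hypergraph V1 W1 E \<and> proper_hypergraph V2 W2 F \<and>
            leads_q V1 W1 E V2 W2 F \<and> \<not> leads_loc V1 W1 E V2 W2 F)
       \<and> (\<exists>(V1 :: nat set) (W1 :: nat set) E (V2 :: nat set) (W2 :: nat set) F.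
            proper_hypergraph V1 W1 E \<and> proper_hypergraph V2 W2 F \<and>
            leads_ns V1 W1 E V2 W2 F \<and> \<not> leads_q V1 W1 E V2 W2 F)"
proof (intro conjI exI)
  show "proper_hypergraph {..<6} {..<6} (Id_on {..<6::nat})"
    by (auto simp: proper_hypergraph_def hypergraph_def lessThan_empty_iff)
  show "proper_hypergraph {..<18} {..<24} pm_incidence"
    by (auto simp: proper_hypergraph_def hypergraph_def pm_incidence_def lessThan_empty_iff)
  show "leads_q {..<6::nat} {..<6::nat} (Id_on {..<6}) {..<18} {..<24} pm_incidence"
    by (rule leads_q_pm)
  show "\<not> leads_loc {..<6::nat} {..<6::nat} (Id_on {..<6}) {..<18} {..<24} pm_incidence"
    by (rule not_leads_loc_pm)
  show "proper_hypergraph {..<2} {..<2} (Id_on {..<2::nat})"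
    by (auto simp: proper_hypergraph_def hypergraph_def lessThan_empty_iff)
  show "proper_hypergraph {..<6} {..<4} K4_edge_triangle"
    by (auto simp: proper_hypergraph_def hypergraph_def K4_edge_triangle_def lessThan_empty_iff)
  show "leads_ns {..<2::nat} {..<2::nat} (Id_on {..<2}) {..<6} {..<4} K4_edge_triangle"
    by (rule leads_ns_K4)
  show "\<not> leads_q {..<2::nat} {..<2::nat} (Id_on {..<2}) {..<6} {..<4} K4_edge_triangle"
    by (rule not_leads_q_two_faces[OF _ _ K4_uncovered]) auto
qed

end
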